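(* Let $\Gamma$ be a finite tree with $n\ge 3$ vertices and let $G$ be a group of automorphisms of $\Gamma$, acting on the vertex set. If $(\Gamma,G)$ is a reciprocal pair, then: (a) $n$ is odd; (b) $\Gamma$ is a star; (c) writing $n=2k+1$, we have $(C_2)^k\le G\le C_2\wr S_k$ (as permutation groups on the vertex set, with $(C_2)^k$ generated by $k$ disjoint transpositions swapping leaves of the star in pairs, and $C_2\wr S_k$ the stabiliser of this pairing fixing the centre). Conversely, any pair $(\Gamma,G)$, with $\Gamma$ a tree on $n\ge3$ vertices and $G\le\mathrm{Aut}(\Gamma)$, satisfying (a), (b) and (c) is a reciprocal pair.
   Context: For a permutation group $G$ on a finite set $\Omega$ with $|\Omega|=n$, the cycle polynomial is $F_G(x)=\sum_{g\in G}x^{c(g)}$, where $c(g)$ is the number of cycles of $g$ on $\Omega$ (including fixed points). For a finite simple graph $\Gamma$ and $g\in\mathrm{Aut}(\Gamma)$, $\Gamma/g$ is the graph whose vertices are the cycles of $g$ on the vertex set, two such vertices (possibly equal, giving a loop) being joined if some edge of $\Gamma$ joins a vertex of one cycle to a vertex of the other; $P_{\Gamma/g}(x)$ is its chromatic polynomial (which is $0$ if $\Gamma/g$ has a loop). For $G\le\mathrm{Aut}(\Gamma)$ the orbital chromatic polynomial is $P_{\Gamma,G}(x)=\sum_{g\in G}P_{\Gamma/g}(x)$. The pair $(\Gamma,G)$ is a reciprocal pair if $P_{\Gamma,G}(x)=(-1)^nF_G(-x)$, where $n$ is the number of vertices of $\Gamma$ and $F_G$ is computed for the action of $G$ on the vertices.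 A star is a tree in which one vertex is adjacent to all others. *)

theory Defs
  imports
    "HOL-Computational_Algebra.Polynomial"
    "HOL-Combinatorics.Orbits"
    "HOL-Library.Disjoint_Sets"
    "HOL-Algebra.Generated_Groups"
    "Graph_Theory.Digraph_Component"
begin

text \<open>
  Simple graphs are the symmetric loop-free finite digraphs \<open>pair_graph\<close> of
  Graph_Theory: an edge \<open>{u,v}\<close> is the pair of arcs \<open>(u,v)\<close>, \<open>(v,u)\<close>.
  Quotient graphs live in the same record type, where \<open>(A,A)\<close> is a loop.

  The predicate \<open>tree\<close> of Graph_Theory is not usable here, since \<open>cycle\<close> counts
  the closed walk \<open>[(u,v), (v,u)]\<close> as a cycle.  For a \<open>pair_graph\<close>, the undirected
  cycles are exactly the directed cycles of length at least 3.
\<close>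

definition is_tree :: "'a pair_pre_digraph \<Rightarrow> bool" where
  "is_tree \<Gamma> \<longleftrightarrow> pair_graph \<Gamma> \<and> Digraph_Component.connected (with_proj \<Gamma>) \<and>
     \<not> (\<exists>p. pre_digraph.cycle (with_proj \<Gamma>) p \<and> 3 \<le> length p)"

definition star_centre :: "'a pair_pre_digraph \<Rightarrow> 'a \<Rightarrow> bool" where
  "star_centre \<Gamma> c \<longleftrightarrow> c \<in> pverts \<Gamma> \<and> (\<forall>v \<in> pverts \<Gamma> - {c}. (c, v) \<in> parcs \<Gamma>)"

definition is_star :: "'a pair_pre_digraph \<Rightarrow> bool" where
  "is_star \<Gamma> \<longleftrightarrow> is_tree \<Gamma> \<and> (\<exists>c. star_centre \<Gamma> c)"

definition symmetric_group_on :: "'a set \<Rightarrow> ('a \<Rightarrow> 'a) monoid" where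
  "symmetric_group_on V = \<lparr> carrier = {p. p permutes V}, mult = (\<circ>), one = id \<rparr>"

definition aut_group :: "'a pair_pre_digraph \<Rightarrow> ('a \<Rightarrow> 'a) monoid" where
  "aut_group \<Gamma> = (symmetric_group_on (pverts \<Gamma>))
     \<lparr> carrier := {p. p permutes pverts \<Gamma> \<and>
         (\<forall>u \<in> pverts \<Gamma>. \<forall>v \<in> pverts \<Gamma>. (p u, p v) \<in> parcs \<Gamma> \<longleftrightarrow> (u, v) \<in> parcs \<Gamma>)} \<rparr>"

text \<open>The cycles of a permutation, fixed points included, as sets of points.\<close>

definition perm_cycles :: "'a set \<Rightarrow> ('a \<Rightarrow> 'a) \<Rightarrow> 'a set set" where
  "perm_cycles V g = orbit g ` V"

definition cycle_poly :: "'a set \<Rightarrow> ('a \<Rightarrow> 'a) set \<Rightarrow> real poly" where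
  "cycle_poly V G = (\<Sum>g\<in>G. monom 1 (card (perm_cycles V g)))"

definition quotient_graph :: "'a pair_pre_digraph \<Rightarrow> ('a \<Rightarrow> 'a) \<Rightarrow> 'a set pair_pre_digraph" where
  "quotient_graph \<Gamma> g =
     \<lparr> pverts = perm_cycles (pverts \<Gamma>) g,
       parcs = {(A, B). A \<in> perm_cycles (pverts \<Gamma>) g \<and> B \<in> perm_cycles (pverts \<Gamma>) g \<and>
                        (\<exists>u\<in>A. \<exists>v\<in>B. (u, v) \<in> parcs \<Gamma>)} \<rparr>"

definition proper_colourings :: "'a pair_pre_digraph \<Rightarrow> nat \<Rightarrow> ('a \<Rightarrow> nat) set" where
  "proper_colourings \<Gamma> q =
     {f \<in> pverts \<Gamma> \<rightarrow>\<^sub>E {..<q}. \<forall>(u, v) \<in> parcs \<Gamma>. f u \<noteq> f v}"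

text \<open>Existence and uniqueness are established in \<open>poly_chromatic_poly\<close> below.\<close>

definition chromatic_poly :: "'a pair_pre_digraph \<Rightarrow> real poly" where
  "chromatic_poly \<Gamma> =
     (THE P. \<forall>q::nat. poly P (real q) = real (card (proper_colourings \<Gamma> q)))"

definition orbital_chromatic_poly :: "'a pair_pre_digraph \<Rightarrow> ('a \<Rightarrow> 'a) set \<Rightarrow> real poly" where
  "orbital_chromatic_poly \<Gamma> G = (\<Sum>g\<in>G. chromatic_poly (quotient_graph \<Gamma> g))"

definition reciprocal_pair :: "'a pair_pre_digraph \<Rightarrow> ('a \<Rightarrow> 'a) set \<Rightarrow> bool" where
  "reciprocal_pair \<Gamma> G \<longleftrightarrow>
     orbital_chromatic_poly \<Gamma> G =
       smult ((-1) ^ card (pverts \<Gamma>)) (pcompose (cycle_poly (pverts \<Gamma>) G) [:0, -1:])"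

definition leaf_pairing :: "'a pair_pre_digraph \<Rightarrow> 'a \<Rightarrow> 'a set set \<Rightarrow> bool" where
  "leaf_pairing \<Gamma> c M \<longleftrightarrow> partition_on (pverts \<Gamma> - {c}) M \<and> (\<forall>B\<in>M. card B = 2)"

text \<open>
  With \<open>k = card M\<close>, these are \<open>(C\<^sub>2)\<^sup>k\<close> and \<open>C\<^sub>2 wr S\<^sub>k\<close> as permutation
  groups on the vertex set \<open>V\<close> of a star with centre \<open>c\<close>.
\<close>

definition pair_swap_group :: "'a set \<Rightarrow> 'a set set \<Rightarrow> ('a \<Rightarrow> 'a) set" where
  "pair_swap_group V M = generate (symmetric_group_on V) {transpose a b | a b. {a, b} \<in> M}"

definition pairing_stabiliser :: "'a set \<Rightarrow> 'a \<Rightarrow> 'a set set \<Rightarrow> ('a \<Rightarrow> 'a) set" where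
  "pairing_stabiliser V c M =
     {p \<in> carrier (symmetric_group_on V). p c = c \<and> (\<lambda>B. p ` B) ` M = M}"

lemma poly_eq_if_eq_on_nats:
  fixes P Q :: "real poly"
  assumes "\<And>q::nat. poly P (real q) = poly Q (real q)"
  shows "P = Q"
proof (rule ccontr)
  assume "P \<noteq> Q"
  hence "finite {x. poly (P - Q) x = 0}"
    by (intro poly_roots_finite) auto
  moreover have "range real \<subseteq> {x. poly (P - Q) x = 0}"
    using assms by auto
  ultimately have "finite (range real)"
    using finite_subset by blast
  thus False
    using finite_imageD[of real UNIV] by (auto simp: inj_on_def)
qed

lemma chromatic_poly_exists:
  fixes \<Gamma> :: "'a pair_pre_digraph"
  assumes wf: "pair_wf_digraph \<Gamma>" and fin: "finite (pverts \<Gamma>)"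
  shows "\<exists>P::real poly. \<forall>q::nat. poly P (real q) = real (card (proper_colourings \<Gamma> q))"
proof -
  let ?V = "pverts \<Gamma>" and ?N = "card (pverts \<Gamma>)"
  define S :: "nat set \<Rightarrow> ('a \<Rightarrow> nat) set" where
    "S T = {f \<in> ?V \<rightarrow>\<^sub>E T. f ` ?V = T \<and> (\<forall>(u, v) \<in> parcs \<Gamma>. f u \<noteq> f v)}" for T
  define s where "s k = card (S {..<k})" for k
  have inV: "u \<in> ?V" "v \<in> ?V" if "(u, v) \<in> parcs \<Gamma>" for u v
    using pair_wf_digraph.in_arcsD1[OF wf that] pair_wf_digraph.in_arcsD2[OF wf that] by auto
  have finS: "finite (S T)" if "finite T" for T
    unfolding S_def using finite_PiE[OF fin, of "\<lambda>_. T"] that by auto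
  have transfer: "(\<lambda>f. restrict (h \<circ> f) ?V) ` S T \<subseteq> S T'" if "bij_betw h T T'" for h T T'
  proof (rule image_subsetI)
    fix f assume "f \<in> S T"
    hence f: "f ` ?V = T" "\<And>u v. (u, v) \<in> parcs \<Gamma> \<Longrightarrow> f u \<noteq> f v"
      by (auto simp: S_def)
    have h: "inj_on h T" "h ` T = T'" using that by (auto simp: bij_betw_def)
    have "restrict (h \<circ> f) ?V ` ?V = T'" using f(1) h(2) by (auto simp: image_iff)
    moreover have "restrict (h \<circ> f) ?V u \<noteq> restrict (h \<circ> f) ?V v" if "(u, v) \<in> parcs \<Gamma>" for u v
      using f inV[OF that] that inj_onD[OF h(1), of "f u" "f v"] by auto
    moreover have "restrict (h \<circ> f) ?V \<in> ?V \<rightarrow>\<^sub>E T'" using f(1) h(2) by auto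
    ultimately show "restrict (h \<circ> f) ?V \<in> S T'" unfolding S_def by blast
  qed
  have le: "card (S T) \<le> card (S T')" if "bij_betw h T T'" "finite T'" for h T T'
  proof (rule card_inj_on_le[OF _ transfer[OF that(1)] finS[OF that(2)]])
    show "inj_on (\<lambda>f. restrict (h \<circ> f) ?V) (S T)"
    proof (rule inj_onI)
      fix f g assume fg: "f \<in> S T" "g \<in> S T" "restrict (h \<circ> f) ?V = restrict (h \<circ> g) ?V"
      show "f = g"
      proof (rule extensionalityI[of _ ?V])
        fix x assume x: "x \<in> ?V"
        have "h (f x) = h (g x)" using fun_cong[OF fg(3), of x] x by simp
        moreover have "f x \<in> T" "g x \<in> T" using fg(1,2) x by (auto simp: S_def)
        ultimately show "f x = g x"
          using that(1) by (auto simp: bij_betw_def inj_on_def)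
      qed (use fg in \<open>auto simp: S_def PiE_def\<close>)
    qed
  qed
  have card_S: "card (S T) = s (card T)" if finT: "finite T" for T
  proof -
    obtain h where h: "bij_betw h T {..<card T}"
      using ex_bij_betw_finite_nat[OF finT] by (auto simp: atLeast0LessThan)
    show ?thesis
      unfolding s_def
      using le[OF h] le[OF bij_betw_inv_into[OF h] finT] by simp
  qed
  have s0: "s k = 0" if "k > ?N" for k
  proof -
    have "f ` ?V \<noteq> {..<k}" for f :: "'a \<Rightarrow> nat"
      using card_image_le[OF fin, of f] that by (metis card_lessThan leD)
    hence "S {..<k} = {}" by (auto simp: S_def)
    thus ?thesis by (simp add: s_def)
  qed
  have count: "card (proper_colourings \<Gamma> q) = (\<Sum>k\<le>?N. s k * (q choose k))" for q
  proof -
    have "proper_colourings \<Gamma> q = (\<Union>T \<in> Pow {..<q}. S T)"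
    proof (intro equalityI subsetI)
      fix f assume "f \<in> proper_colourings \<Gamma> q"
      hence "f ` ?V \<in> Pow {..<q}" "f \<in> S (f ` ?V)"
        by (auto simp: proper_colourings_def S_def PiE_def)
      thus "f \<in> (\<Union>T \<in> Pow {..<q}. S T)" by blast
    qed (auto simp: proper_colourings_def S_def PiE_def)
    hence "card (proper_colourings \<Gamma> q) = (\<Sum>T \<in> Pow {..<q}. card (S T))"
      using finS finite_subset[OF _ finite_lessThan]
      by (simp, intro card_UN_disjoint) (auto simp: S_def)
    also have "\<dots> = (\<Sum>T \<in> Pow {..<q}. s (card T))"
      by (intro sum.cong) (auto intro!: card_S finite_subset[OF _ finite_lessThan])
    also have "\<dots> = (\<Sum>k\<le>q. \<Sum>T \<in> {T \<in> Pow {..<q}. card T = k}. s (card T))"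
      by (rule sum.group[symmetric]) (use card_mono[OF finite_lessThan[of q]] in auto)
    also have "\<dots> = (\<Sum>k\<le>q. s k * (q choose k))"
      using n_subsets[OF finite_lessThan[of q]] by (intro sum.cong) (auto simp: mult.commute)
    also have "\<dots> = (\<Sum>k\<le>max q ?N. s k * (q choose k))"
      by (intro sum.mono_neutral_left) auto
    also have "\<dots> = (\<Sum>k\<le>?N. s k * (q choose k))"
      by (intro sum.mono_neutral_right) (auto simp: s0)
    finally show ?thesis .
  qed
  define P :: "real poly" where
    "P = (\<Sum>k\<le>?N. smult (real (s k) / fact k) (\<Prod>i = 0..<k. [:- real i, 1:]))"
  have "poly P (real q) = real (card (proper_colourings \<Gamma> q))" for q
    unfolding P_def count
    by (simp add: poly_sum poly_prod binomial_gbinomial gbinomial_prod_rev)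
  thus ?thesis by blast
qed

lemma poly_chromatic_poly:
  assumes "pair_wf_digraph \<Gamma>" "finite (pverts \<Gamma>)"
  shows "poly (chromatic_poly \<Gamma>) (real q) = real (card (proper_colourings \<Gamma> q))"
proof -
  have "\<exists>!P::real poly. \<forall>q::nat. poly P (real q) = real (card (proper_colourings \<Gamma> q))"
    using chromatic_poly_exists[OF assms] by (auto intro!: poly_eq_if_eq_on_nats)
  from theI'[OF this] show ?thesis
    unfolding chromatic_poly_def by blast
qed

lemma pair_wf_quotient_graph: "pair_wf_digraph (quotient_graph \<Gamma> g)"
  by unfold_locales (auto simp: quotient_graph_def)

lemma poly_chromatic_poly_quotient_graph:
  assumes "finite (pverts \<Gamma>)"
  shows "poly (chromatic_poly (quotient_graph \<Gamma> g)) (real q) =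
           real (card (proper_colourings (quotient_graph \<Gamma> g) q))"
  using assms
  by (intro poly_chromatic_poly pair_wf_quotient_graph) (simp add: quotient_graph_def perm_cycles_def)

end

theory Submission
  imports Defs
begin

text \<open>
  An automorphism \<open>g\<close> of a tree that fixes a vertex has a tree as its quotient, so
  \<open>P(\<Gamma>/g) = x (x - 1) ^ (c(g) - 1)\<close>. Hence the coefficients of \<open>x ^ (n - 1)\<close> show that a reciprocal
  group contains exactly \<open>(n - 1)/2\<close> transpositions, and evaluation at 2 shows that they are disjoint.
  Transposed vertices are leaves, so all vertices but one are leaves and the tree is a star.
  Conversely, for the action on the leaves of a star the claim reads
  \<open>(\<Sum>g. (q - 1) ^ c(g)) = (\<Sum>g. (- q) ^ c(g))\<close>. The left-hand side counts pairs of a group element and an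
  invariant colouring with \<open>q - 1\<close> colours. On the right, colourings with a monochromatic pair cancel,
  and the others count positively. By Burnside's lemma, for each assignment of unordered pairs of colours
  to the pairs of leaves both sides contribute the order of its stabiliser.
\<close>

section \<open>Cycles and invariant colourings of a permutation\<close>

text \<open>\<open>G\<close> is only known to lie between \<open>(C_2)^k\<close> and
  \<open>C_2 wr S_k\<close>, so no cycle index formula for a wreath product applies. This is why the
  converse is proved separately for each assignment of colour pairs, where only the swaps and their
  compatibility with \<open>G\<close> enter. An automorphism of a tree may reverse an edge and fix
  no vertex, and then the formula for its quotient fails. The necessity proof is arranged to need
  that formula only for the identity and, since \<open>n \<ge> 3\<close>, for transpositions: any
  other element has at most \<open>n - 2\<close> cycles and cannot reach the coefficient of
  \<open>x ^ (n - 1)\<close>, and at 2 only the non-negativity of its term is used. Cycle numbers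
  are accessible through the fact that \<open>g\<close> has \<open>q ^ c(g)\<close> invariant
  colourings with \<open>q\<close> colours; even the effect of a transposition on
  \<open>c(g)\<close> is read off at \<open>q = 2\<close>.\<close>

lemma perm_cycles_memD:
  assumes "finite A" "g permutes A" "B \<in> perm_cycles A g" "x \<in> B"
  shows "x \<in> A" "B = orbit g x"
proof -
  obtain a where a: "a \<in> A" "B = orbit g a" using assms by (auto simp: perm_cycles_def)
  show "x \<in> A" using permutes_orbit_subset[OF assms(2) a(1)] a assms by auto
  show "B = orbit g x"
    using orbit_cyclic_eq3[OF cyclic_on_orbit[OF assms(2,1), of a]] assms(4) a by simp
qed

lemma self_in_orbit_permutes: "finite A \<Longrightarrow> g permutes A \<Longrightarrow> x \<in> orbit g x"
  by (meson permutation_permutes permutation_self_in_orbit)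

lemma orbit_image_permutes: "finite A \<Longrightarrow> g permutes A \<Longrightarrow> orbit g (g x) = orbit g x"
  by (meson permutation_permutes permutation_orbit_step)

lemma finite_perm_cycles: "finite A \<Longrightarrow> finite (perm_cycles A g)"
  by (simp add: perm_cycles_def)

lemma card_perm_cycles_le: "finite A \<Longrightarrow> card (perm_cycles A g) \<le> card A"
  unfolding perm_cycles_def by (rule card_image_le)

lemma card_perm_cycles_id: "card (perm_cycles A id) = card A"
proof -
  have "orbit id x = {x}" for x :: 'a by (simp add: orbit_eq_singleton_iff)
  hence "orbit id = (\<lambda>x::'a. {x})" by auto
  thus ?thesis unfolding perm_cycles_def by (simp add: card_image)
qed

lemma card_perm_cycles_eq_iff:
  assumes "finite A" "g permutes A"
  shows "card (perm_cycles A g) = card A \<longleftrightarrow> g = id"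
proof
  assume "card (perm_cycles A g) = card A"
  hence inj: "inj_on (orbit g) A"
    unfolding perm_cycles_def using eq_card_imp_inj_on[OF assms(1)] by blast
  show "g = id"
  proof
    fix x
    show "g x = id x"
      using inj_onD[OF inj, of "g x" x] orbit_image_permutes[OF assms] assms(2)
      by (cases "x \<in> A") (auto simp: permutes_in_image permutes_not_in)
  qed
qed (simp add: card_perm_cycles_id)

definition invariant_colourings :: "'a set \<Rightarrow> nat \<Rightarrow> ('a \<Rightarrow> 'a) \<Rightarrow> ('a \<Rightarrow> nat) set" where
  "invariant_colourings A q g = {f \<in> A \<rightarrow>\<^sub>E {..<q}. \<forall>x\<in>A. f (g x) = f x}"

lemma invariant_on_orbit:
  assumes "finite A" "g permutes A" "\<And>x. x \<in> A \<Longrightarrow> f (g x) = f x" "x \<in> A" "y \<in> orbit g x"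
  shows "f y = f x"
proof -
  have "f y = f x \<and> y \<in> A" using assms(5)
    by induction (use assms in \<open>auto simp: permutes_in_image\<close>)
  thus ?thesis ..
qed

lemma bij_betw_invariant_colourings:
  assumes "finite A" "g permutes A"
  shows "bij_betw (\<lambda>\<phi>. \<lambda>x\<in>A. \<phi> (orbit g x)) (perm_cycles A g \<rightarrow>\<^sub>E {..<q}) (invariant_colourings A q g)"
proof (rule bij_betwI[where g = "\<lambda>f. \<lambda>B\<in>perm_cycles A g. f (SOME x. x \<in> B)"])
  show "(\<lambda>\<phi>. \<lambda>x\<in>A. \<phi> (orbit g x)) \<in> (perm_cycles A g \<rightarrow>\<^sub>E {..<q}) \<rightarrow> invariant_colourings A q g"
    using assms by (auto simp: invariant_colourings_def orbit_image_permutes permutes_in_image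
        perm_cycles_def PiE_def Pi_def)
  have some: "(SOME x. x \<in> B) \<in> B" if "B \<in> perm_cycles A g" for B
    using that orbit_nonempty[of g] by (auto simp: perm_cycles_def some_in_eq)
  show "(\<lambda>f. \<lambda>B\<in>perm_cycles A g. f (SOME x. x \<in> B)) \<in> invariant_colourings A q g \<rightarrow> (perm_cycles A g \<rightarrow>\<^sub>E {..<q})"
    using perm_cycles_memD(1)[OF assms _ some] by (fastforce simp: invariant_colourings_def)
  fix \<phi> assume phi: "\<phi> \<in> perm_cycles A g \<rightarrow>\<^sub>E {..<q}"
  show "(\<lambda>B\<in>perm_cycles A g. (\<lambda>x\<in>A. \<phi> (orbit g x)) (SOME x. x \<in> B)) = \<phi>"
  proof (rule extensionalityI)
    fix B assume B: "B \<in> perm_cycles A g"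
    show "(\<lambda>B\<in>perm_cycles A g. (\<lambda>x\<in>A. \<phi> (orbit g x)) (SOME x. x \<in> B)) B = \<phi> B"
      using perm_cycles_memD[OF assms B some[OF B]] B by simp
  qed (use phi in \<open>auto simp: PiE_def\<close>)
next
  have some: "(SOME x. x \<in> B) \<in> B" if "B \<in> perm_cycles A g" for B
    using that orbit_nonempty[of g] by (auto simp: perm_cycles_def some_in_eq)
  fix f assume f: "f \<in> invariant_colourings A q g"
  show "(\<lambda>x\<in>A. (\<lambda>B\<in>perm_cycles A g. f (SOME x. x \<in> B)) (orbit g x)) = f"
  proof (rule extensionalityI)
    fix x assume x: "x \<in> A"
    hence B: "orbit g x \<in> perm_cycles A g" by (auto simp: perm_cycles_def)
    show "(\<lambda>x\<in>A. (\<lambda>B\<in>perm_cycles A g. f (SOME x. x \<in> B)) (orbit g x)) x = f x"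
      using invariant_on_orbit[OF assms, of f, OF _ x some[OF B]] f x B
      by (simp add: invariant_colourings_def)
  qed (use f in \<open>auto simp: invariant_colourings_def PiE_def\<close>)
qed

lemma card_invariant_colourings:
  assumes "finite A" "g permutes A"
  shows "card (invariant_colourings A q g) = q ^ card (perm_cycles A g)"
  using bij_betw_same_card[OF bij_betw_invariant_colourings[OF assms, of q]]
    finite_perm_cycles[OF assms(1), of g] by (simp add: card_funcsetE)

text \<open>\<open>transpose a (g a) \<circ> g\<close> splits the fixed point \<open>a\<close> off its \<open>g\<close>-cycle, so an invariant colouring
  of it is one of \<open>g\<close> together with a free colour for \<open>a\<close>.\<close>
lemma card_perm_cycles_split:
  assumes "finite A" "g permutes A" "g a \<noteq> a"
  shows "card (perm_cycles A (transpose a (g a) \<circ> g)) = Suc (card (perm_cycles A g))"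
proof -
  let ?h = "transpose a (g a) \<circ> g"
  have a: "a \<in> A" using assms by (meson permutes_not_in)
  hence ga: "g a \<in> A" using assms by (simp add: permutes_in_image)
  have h: "?h permutes A" using a ga assms by (intro permutes_compose permutes_swap_id)
  have ha: "?h a = a" by simp
  \<comment> \<open>The point that \<open>g\<close> sends to \<open>a\<close> is redirected to
    \<open>g a\<close>: \<open>?h\<close> runs through the old cycle, skipping
    \<open>a\<close>.\<close>
  have hx: "?h x = (if g x = a then g a else g x)" if "x \<noteq> a" for x
    using that assms(2) by (auto simp: transpose_def dest: permutes_inj[THEN injD])
  \<comment> \<open>Two colours are enough, since a power of 2 determines its exponent. The inverse
    gives \<open>a\<close> the colour of \<open>g a\<close> and records its free colour.\<close>
  have "bij_betw (\<lambda>(f, i). f(a := i)) (invariant_colourings A 2 g \<times> {..<2}) (invariant_colourings A 2 ?h)"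
  proof (rule bij_betwI[where g = "\<lambda>f. (f(a := f (g a)), f a)"])
    show "(\<lambda>(f, i). f(a := i)) \<in> invariant_colourings A 2 g \<times> {..<2} \<rightarrow> invariant_colourings A 2 ?h"
    proof (rule funcsetI, safe)
      fix f :: "'a \<Rightarrow> nat" and i :: nat
      assume "f \<in> invariant_colourings A 2 g" and i: "i < 2"
      hence f: "f \<in> A \<rightarrow>\<^sub>E {..<2}" "\<And>x. x \<in> A \<Longrightarrow> f (g x) = f x"
        by (auto simp: invariant_colourings_def)
      have "f(a := i) \<in> A \<rightarrow>\<^sub>E {..<2}" using f(1) i a by (auto simp: PiE_def Pi_def extensional_def)
      moreover have "(f(a := i)) (?h x) = (f(a := i)) x" if x: "x \<in> A" for x
      proof (cases "x = a")
        case True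
        thus ?thesis by (simp add: ha del: o_apply)
      next
        case False
        have "f (g a) = f a" "f (g x) = f x" using f(2) a x by auto
        thus ?thesis using hx[OF False] False assms(3) by (auto simp del: o_apply)
      qed
      ultimately show "f(a := i) \<in> invariant_colourings A 2 ?h"
        by (auto simp: invariant_colourings_def)
    qed
    show "(\<lambda>f. (f(a := f (g a)), f a)) \<in> invariant_colourings A 2 ?h \<rightarrow> invariant_colourings A 2 g \<times> {..<2}"
    proof
      fix f assume "f \<in> invariant_colourings A 2 ?h"
      hence f: "f \<in> A \<rightarrow>\<^sub>E {..<2}" "\<And>x. x \<in> A \<Longrightarrow> f (?h x) = f x"
        by (auto simp: invariant_colourings_def)
      have "f(a := f (g a)) \<in> A \<rightarrow>\<^sub>E {..<2}" "f a < 2"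
        using f(1) a ga by (auto simp: PiE_def Pi_def extensional_def)
      moreover have "(f(a := f (g a))) (g x) = (f(a := f (g a))) x" if x: "x \<in> A" for x
      proof (cases "x = a")
        case False
        thus ?thesis using f(2)[OF x] hx[OF False] by (auto simp del: o_apply split: if_splits)
      qed (simp add: assms(3))
      ultimately show "(f(a := f (g a)), f a) \<in> invariant_colourings A 2 g \<times> {..<2}"
        by (auto simp: invariant_colourings_def)
    qed
  next
    fix p assume p: "p \<in> invariant_colourings A 2 g \<times> {..<2::nat}"
    then obtain f i where fi: "p = (f, i)" "f (g a) = f a" using a by (auto simp: invariant_colourings_def)
    show "(\<lambda>f. (f(a := f (g a)), f a)) ((\<lambda>(f, i). f(a := i)) p) = p"
      using assms(3) fi by auto
  qed auto
  from bij_betw_same_card[OF this] have "(2::nat) ^ card (perm_cycles A ?h) = 2 ^ Suc (card (perm_cycles A g))"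
    by (simp add: card_invariant_colourings assms h card_cartesian_product del: o_apply)
  thus ?thesis by (simp only: power_inject_exp)
qed

text \<open>Splitting off one moved point yields \<open>card A\<close> cycles, hence the identity,
  so \<open>g\<close> is the transposition used for the split.\<close>

lemma card_perm_cycles_eq_card_minus_one_iff:
  assumes "finite A" "g permutes A"
  shows "Suc (card (perm_cycles A g)) = card A \<longleftrightarrow> (\<exists>a b. a \<noteq> b \<and> a \<in> A \<and> b \<in> A \<and> g = transpose a b)"
proof
  assume *: "Suc (card (perm_cycles A g)) = card A"
  hence "g \<noteq> id" using card_perm_cycles_id[of A] by auto
  then obtain a where a: "g a \<noteq> a" by (auto simp: fun_eq_iff)
  hence aA: "a \<in> A" using assms by (meson permutes_not_in)
  hence ga: "g a \<in> A" using assms by (simp add: permutes_in_image)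
  have "transpose a (g a) \<circ> g permutes A" using aA ga assms by (intro permutes_compose permutes_swap_id)
  hence "transpose a (g a) \<circ> g = id"
    using card_perm_cycles_eq_iff[OF assms(1)] card_perm_cycles_split[OF assms a] * by simp
  hence "g = transpose a (g a)"
    by (metis comp_assoc comp_id id_comp transpose_comp_involutory)
  thus "\<exists>a b. a \<noteq> b \<and> a \<in> A \<and> b \<in> A \<and> g = transpose a b" using a aA ga by metis
next
  assume "\<exists>a b. a \<noteq> b \<and> a \<in> A \<and> b \<in> A \<and> g = transpose a b"
  then obtain a b where ab: "a \<noteq> b" "a \<in> A" "b \<in> A" "g = transpose a b" by blast
  thus "Suc (card (perm_cycles A g)) = card A"
    using card_perm_cycles_split[OF assms, of a] card_perm_cycles_id[of A]
    by (simp add: transpose_comp_involutory)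
qed

text \<open>Each split composes with one transposition, which reverses the sign, and adds one cycle;
  the process ends at the identity with \<open>card A\<close> cycles.\<close>

lemma sign_eq_card_perm_cycles:
  assumes "finite A" "g permutes A"
  shows "sign g = (-1) ^ (card A + card (perm_cycles A g))"
  using assms(2)
proof (induction "card A - card (perm_cycles A g)" arbitrary: g rule: less_induct)
  case less
  show ?case
  proof (cases "g = id")
    case True
    thus ?thesis by (simp add: card_perm_cycles_id del: id_apply flip: mult_2)
  next
    case False
    then obtain a where a: "g a \<noteq> a" by (auto simp: fun_eq_iff)
    let ?h = "transpose a (g a) \<circ> g"
    have aA: "a \<in> A" using a less.prems by (meson permutes_not_in)
    hence ga: "g a \<in> A" using less.prems by (simp add: permutes_in_image)
    have h: "?h permutes A" using aA ga less.prems by (intro permutes_compose permutes_swap_id)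
    note split = card_perm_cycles_split[OF assms(1) less.prems a]
    have "card A - card (perm_cycles A ?h) < card A - card (perm_cycles A g)"
      using split card_perm_cycles_le[OF assms(1), of ?h] by simp
    from less.hyps[OF this h]
    have "sign ?h = - ((-1) ^ (card A + card (perm_cycles A g)))" using split by simp
    moreover have "sign ?h = - sign g"
      using a less.prems assms(1) permutation_permutes permutation_swap_id[of a "g a"]
      by (subst sign_compose) (auto simp: sign_swap_id)
    ultimately show ?thesis by simp
  qed
qed

lemma minus_one_power_perm_cycles_comp_transpose:
  assumes "finite A" "g permutes A" "a \<in> A" "b \<in> A" "a \<noteq> b"
  shows "(-1::real) ^ card (perm_cycles A (g \<circ> transpose a b)) = - ((-1) ^ card (perm_cycles A g))"
proof -
  have p: "g \<circ> transpose a b permutes A" using assms by (intro permutes_compose permutes_swap_id)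
  have "sign (g \<circ> transpose a b) = - sign g"
    using assms(1,2,5) permutation_permutes permutation_swap_id[of a b]
    by (subst sign_compose) (auto simp: sign_swap_id)
  hence "even (card (perm_cycles A (g \<circ> transpose a b))) \<noteq> even (card (perm_cycles A g))"
    unfolding sign_eq_card_perm_cycles[OF assms(1,2)] sign_eq_card_perm_cycles[OF assms(1) p]
    by (auto simp: minus_one_power_iff split: if_splits)
  thus ?thesis by (auto simp: minus_one_power_iff)
qed

text \<open>Composition with the transposition of two equally coloured points is a sign-reversing
  involution on the stabiliser.\<close>
lemma signed_stabiliser_sum_eq_0:
  fixes G :: "('a \<Rightarrow> 'a) set" and f :: "'a \<Rightarrow> 'b"
  assumes "finite A" "\<And>g. g \<in> G \<Longrightarrow> g permutes A" "a \<in> A" "b \<in> A" "a \<noteq> b" "f a = f b"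
    and "\<And>g. g \<in> G \<Longrightarrow> g \<circ> transpose a b \<in> G"
  shows "(\<Sum>g\<in>{g\<in>G. \<forall>x\<in>A. f (g x) = f x}. (-1::real) ^ card (perm_cycles A g)) = 0" (is "sum ?s ?S = 0")
proof -
  let ?t = "\<lambda>g. g \<circ> transpose a b"
  have inv: "f (transpose a b x) = f x" for x using assms(6) by (auto simp: transpose_def)
  have tt: "?t (?t g) = g" for g :: "'a \<Rightarrow> 'a" by (simp add: comp_assoc)
  have mem: "?t g \<in> ?S" if "g \<in> ?S" for g
    using that assms inv by (auto simp: transpose_def)
  have "sum ?s ?S = (\<Sum>g\<in>?S. ?s (?t g))"
    by (rule sum.reindex_bij_witness[of _ ?t ?t]) (use mem tt in \<open>auto simp del: o_apply\<close>)
  also have "\<dots> = (\<Sum>g\<in>?S. - ?s g)"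
    by (intro sum.cong refl minus_one_power_perm_cycles_comp_transpose) (use assms in auto)
  finally show ?thesis by (simp add: sum_negf)
qed

text \<open>Reading \<open>q ^ c(g)\<close> as a number of invariant colourings and exchanging the
  sums allows cancellation to be studied inside one stabiliser at a time.\<close>

lemma signed_invariant_colourings_sum:
  assumes "finite A" "finite G" "\<And>g. g \<in> G \<Longrightarrow> g permutes A"
  shows "(\<Sum>g\<in>G. (-1) ^ card (perm_cycles A g) * real q ^ card (perm_cycles A g)) =
    (\<Sum>f\<in>A \<rightarrow>\<^sub>E {..<q}. \<Sum>g\<in>{g\<in>G. \<forall>x\<in>A. f (g x) = f x}. (-1::real) ^ card (perm_cycles A g))"
proof -
  let ?F = "A \<rightarrow>\<^sub>E {..<q}" and ?s = "\<lambda>g. (-1::real) ^ card (perm_cycles A g)"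
  have fin: "finite ?F" using assms(1) by (simp add: finite_PiE)
  have "(\<Sum>g\<in>G. ?s g * real q ^ card (perm_cycles A g)) = (\<Sum>g\<in>G. \<Sum>f\<in>{f\<in>?F. \<forall>x\<in>A. f (g x) = f x}. ?s g)"
    by (intro sum.cong refl)
      (use card_invariant_colourings[OF assms(1,3), of _ q, symmetric] in \<open>simp add: invariant_colourings_def flip: of_nat_power\<close>)
  also have "\<dots> = (\<Sum>f\<in>?F. \<Sum>g\<in>{g\<in>G. \<forall>x\<in>A. f (g x) = f x}. ?s g)"
    by (rule sum.swap_restrict[OF assms(2) fin])
  finally show ?thesis .
qed

section \<open>Trees and their quotients\<close>

lemma is_treeD:
  assumes "is_tree \<Gamma>"
  shows "finite (pverts \<Gamma>)" "pair_wf_digraph \<Gamma>" "\<And>u v. (u, v) \<in> parcs \<Gamma> \<Longrightarrow> u \<in> pverts \<Gamma> \<and> v \<in> pverts \<Gamma>"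
    "\<And>u v. (u, v) \<in> parcs \<Gamma> \<Longrightarrow> (v, u) \<in> parcs \<Gamma>" "\<And>u. (u, u) \<notin> parcs \<Gamma>"
    "\<And>u v. u \<in> pverts \<Gamma> \<Longrightarrow> v \<in> pverts \<Gamma> \<Longrightarrow> (u, v) \<in> (parcs \<Gamma>)\<^sup>*"
proof -
  interpret pair_graph \<Gamma> using assms by (simp add: is_tree_def)
  show "finite (pverts \<Gamma>)" "pair_wf_digraph \<Gamma>"
    using pair_finite_verts pair_wf_digraph_axioms by simp_all
  show "\<And>u v. (u, v) \<in> parcs \<Gamma> \<Longrightarrow> u \<in> pverts \<Gamma> \<and> v \<in> pverts \<Gamma>"
    using in_arcsD1 in_arcsD2 by blast
  have s: "symmetric (with_proj \<Gamma>)" by (rule sym_arcs)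
  thus "\<And>u v. (u, v) \<in> parcs \<Gamma> \<Longrightarrow> (v, u) \<in> parcs \<Gamma>" by (simp add: symmetric_def sym_def)
  show "\<And>u. (u, u) \<notin> parcs \<Gamma>" using pair_no_loops by fastforce
  fix u v assume "u \<in> pverts \<Gamma>" "v \<in> pverts \<Gamma>"
  hence "(u, v) \<in> rtrancl_on (pverts \<Gamma>) (parcs \<Gamma>)"
    using assms s adj_mk_symmetric_eq
    by (auto simp: is_tree_def connected_def strongly_connected_def reachable_def)
  thus "(u, v) \<in> (parcs \<Gamma>)\<^sup>*"
    by induction (auto intro: rtrancl_into_rtrancl)
qed

text \<open>Two neighbours of \<open>v\<close> joined by a path avoiding \<open>v\<close> would close a cycle through \<open>v\<close>.\<close>
lemma tree_neighbours_eq_if_connected: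
  assumes "is_tree \<Gamma>" "(v, x) \<in> parcs \<Gamma>" "(v, y) \<in> parcs \<Gamma>"
    and "(x, y) \<in> (parcs \<Gamma> \<inter> (- {v}) \<times> (- {v}))\<^sup>*"
  shows "x = y"
proof (rule ccontr)
  assume "x \<noteq> y"
  interpret pair_graph \<Gamma> using assms(1) by (simp add: is_tree_def)
  \<comment> \<open>The tree without \<open>v\<close>: a simple path found here avoids
    \<open>v\<close>, so closing it through \<open>v\<close> repeats no inner vertex.\<close>
  define H where "H = \<lparr>pverts = pverts \<Gamma> - {v}, parcs = parcs \<Gamma> \<inter> (- {v}) \<times> (- {v})\<rparr>"
  interpret H: pair_wf_digraph H
    by unfold_locales (use is_treeD(3)[OF assms(1)] in \<open>auto simp: H_def\<close>)
  have xv: "x \<noteq> v" "x \<in> pverts \<Gamma>" "v \<in> pverts \<Gamma>" using assms(2) is_treeD(3,5)[OF assms(1)] by blast+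
  have "(x, y) \<in> rtrancl_on (pverts H) (parcs H)"
    using assms(4)
  proof induction
    case base
    show ?case using xv by (auto simp: H_def)
  next
    case (step a b)
    have "(a, b) \<in> parcs H" using step by (simp add: H_def)
    thus ?case using step H.in_arcsD2 by (meson rtrancl_on_into_rtrancl_on)
  qed
  hence "x \<rightarrow>\<^sup>*\<^bsub>with_proj H\<^esub> y" by (simp add: reachable_def)
  then obtain p where p: "H.apath x p y" using H.reachable_apath by auto
  hence p': "set p \<subseteq> parcs H" "pcas x p y" "distinct (pawalk_verts x p)"
    by (auto simp: H.apath_def H.awalk_def)
  have "set (pawalk_verts x p) \<subseteq> pverts H"
    using p H.awalk_verts_in_verts by (auto simp: H.apath_def)
  hence nv: "v \<notin> set (pawalk_verts x p)" by (auto simp: H_def)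
  have pne: "p \<noteq> []" using p' \<open>x \<noteq> y\<close> by auto
  have aw: "awalk x p y" using p' xv by (auto simp: awalk_def H_def)
  have yv: "(y, v) \<in> parcs \<Gamma>" using assms(3) is_treeD(4)[OF assms(1)] by blast
  have aw': "awalk v ((v, x) # p @ [(y, v)]) v"
    using aw yv assms(2) xv by (auto simp: awalk_Cons_iff awalk_Nil_iff)
  have "pawalk_verts x (p @ [(y, v)]) = pawalk_verts x p @ [v]"
    using p'(2) by (induction p arbitrary: x) auto
  hence "cycle ((v, x) # p @ [(y, v)])"
    unfolding cycle_def using aw' p' nv by (intro exI[of _ v]) auto
  \<comment> \<open>Since \<open>x \<noteq> y\<close>, the path is nonempty; this excludes the
    back-and-forth walk of length 2, which \<open>is_tree\<close> tolerates.\<close>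
  moreover have "3 \<le> length ((v, x) # p @ [(y, v)])" using pne by (cases p) auto
  ultimately show False using assms(1) unfolding is_tree_def by blast
qed

section \<open>Distance from a root and the parent map of a tree\<close>

text \<open>Graph distance from \<open>r\<close>. The value is unspecified for an unreachable
  \<open>v\<close>, hence the reachability hypotheses below.\<close>

definition depth :: "'a rel \<Rightarrow> 'a \<Rightarrow> 'a \<Rightarrow> nat" where
  "depth E r v = (LEAST m. (r, v) \<in> E ^^ m)"

lemma depth_predecessor:
  assumes "(r, v) \<in> E\<^sup>*" "v \<noteq> r"
  obtains u where "(r, u) \<in> E\<^sup>*" "(u, v) \<in> E" "depth E r u < depth E r v"
proof -
  have *: "(r, v) \<in> E ^^ depth E r v"
    unfolding depth_def using assms(1) by (auto simp: rtrancl_power intro: LeastI)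
  then obtain m where m: "depth E r v = Suc m" using assms(2) by (cases "depth E r v") auto
  then obtain u where u: "(r, u) \<in> E ^^ m" "(u, v) \<in> E" using * by auto
  have "depth E r u \<le> m" unfolding depth_def by (rule Least_le) (rule u(1))
  thus thesis using that[of u] u m by (auto simp: rtrancl_power)
qed

text \<open>A shortest walk from \<open>r\<close> to \<open>u\<close> meets only vertices shallower
  than \<open>u\<close> before its end, so it misses any other \<open>v\<close> that is at least as
  deep.\<close>

lemma rtrancl_avoiding_deeper:
  assumes "(r, u) \<in> E\<^sup>*" "depth E r u \<le> depth E r v" "u \<noteq> v" "r \<noteq> v"
  shows "(r, u) \<in> (E \<inter> (- {v}) \<times> (- {v}))\<^sup>*"
  using assms(1-3)
proof (induction "depth E r u" arbitrary: u rule: less_induct)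
  case less
  show ?case
  proof (cases "u = r")
    case False
    then obtain w where w: "(r, w) \<in> E\<^sup>*" "(w, u) \<in> E" "depth E r w < depth E r u"
      using depth_predecessor[OF less.prems(1)] by metis
    have "w \<noteq> v" using w less.prems by auto
    hence "(r, w) \<in> (E \<inter> (- {v}) \<times> (- {v}))\<^sup>*" using less w by simp
    thus ?thesis using w less.prems \<open>w \<noteq> v\<close> by (auto intro: rtrancl_into_rtrancl)
  qed simp
qed

text \<open>Both neighbours reach the root without meeting \<open>v\<close>, hence are joined
  outside \<open>v\<close>. Allowing equal depth is what later rules out edges inside one
  level.\<close>

lemma tree_shallow_neighbour_unique:
  assumes "is_tree \<Gamma>" "r \<in> pverts \<Gamma>" "v \<noteq> r" "(v, x) \<in> parcs \<Gamma>" "(v, y) \<in> parcs \<Gamma>"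
    and "depth (parcs \<Gamma>) r x \<le> depth (parcs \<Gamma>) r v" "depth (parcs \<Gamma>) r y \<le> depth (parcs \<Gamma>) r v"
  shows "x = y"
proof -
  let ?R = "parcs \<Gamma> \<inter> (- {v}) \<times> (- {v})"
  note T = is_treeD[OF assms(1)]
  have "(r, x) \<in> ?R\<^sup>*" "(r, y) \<in> ?R\<^sup>*"
    using assms T by (auto intro!: rtrancl_avoiding_deeper)
  moreover have "sym (?R\<^sup>*)" using T(4) by (intro sym_rtrancl) (auto simp: sym_def)
  ultimately have "(x, y) \<in> ?R\<^sup>*" by (meson rtrancl_trans symD)
  thus ?thesis using tree_neighbours_eq_if_connected[OF assms(1,4,5)] by blast
qed

text \<open>A neighbour of \<open>u\<close> at the same depth would be a second shallow neighbour
  beside the predecessor of \<open>u\<close> towards the root.\<close>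

lemma tree_depth_neq:
  assumes "is_tree \<Gamma>" "r \<in> pverts \<Gamma>" "(u, v) \<in> parcs \<Gamma>"
  shows "depth (parcs \<Gamma>) r u \<noteq> depth (parcs \<Gamma>) r v"
proof
  note T = is_treeD[OF assms(1)]
  assume eq: "depth (parcs \<Gamma>) r u = depth (parcs \<Gamma>) r v"
  have False if uv: "(u, v) \<in> parcs \<Gamma>" "u \<noteq> r" "depth (parcs \<Gamma>) r u = depth (parcs \<Gamma>) r v" for u v
  proof -
    obtain w where w: "(w, u) \<in> parcs \<Gamma>" "depth (parcs \<Gamma>) r w < depth (parcs \<Gamma>) r u"
      using depth_predecessor[OF T(6)[OF assms(2)] uv(2)] T(3)[OF uv(1)] by metis
    hence "w = v"
      using tree_shallow_neighbour_unique[OF assms(1,2) uv(2), of w v] T(4) uv by auto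
    thus False using w uv by simp
  qed
  thus False using assms(3) eq T(4,5) by metis
qed

text \<open>The depths of the ends of an edge differ, and the shallower end is the unique shallow
  neighbour of the deeper one; hence all edges are parent edges.\<close>

lemma tree_parent:
  assumes "is_tree \<Gamma>" "r \<in> pverts \<Gamma>"
  obtains p where "\<And>v. v \<in> pverts \<Gamma> \<Longrightarrow> v \<noteq> r \<Longrightarrow> (p v, v) \<in> parcs \<Gamma> \<and> depth (parcs \<Gamma>) r (p v) < depth (parcs \<Gamma>) r v"
    and "\<And>u v. (u, v) \<in> parcs \<Gamma> \<Longrightarrow> u \<noteq> r \<and> p u = v \<or> v \<noteq> r \<and> p v = u"
proof -
  note T = is_treeD[OF assms(1)]
  let ?d = "depth (parcs \<Gamma>) r"
  define p where "p v = (SOME u. (u, v) \<in> parcs \<Gamma> \<and> ?d u < ?d v)" for v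
  have p: "(p v, v) \<in> parcs \<Gamma> \<and> ?d (p v) < ?d v" if "v \<in> pverts \<Gamma>" "v \<noteq> r" for v
    unfolding p_def by (rule someI_ex) (use depth_predecessor[of r v] T(6)[OF assms(2) that(1)] that in metis)
  have deeper: "v \<noteq> r \<and> p v = u" if uv: "(u, v) \<in> parcs \<Gamma>" "?d u < ?d v" for u v
  proof -
    have "?d r = 0" unfolding depth_def by (rule Least_eq_0) simp
    hence "v \<noteq> r" using uv by auto
    moreover have "(v, p v) \<in> parcs \<Gamma>" "?d (p v) \<le> ?d v"
      using p[of v] T(3)[OF uv(1)] calculation T(4)[of "p v" v] by auto
    ultimately show ?thesis using tree_shallow_neighbour_unique[OF assms, of v "p v" u] uv T(4) by auto
  qed
  show thesis
  proof (rule that[of p])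
    show "u \<noteq> r \<and> p u = v \<or> v \<noteq> r \<and> p v = u" if uv: "(u, v) \<in> parcs \<Gamma>" for u v
      using tree_depth_neq[OF assms uv] deeper[OF uv] deeper[OF T(4)[OF uv]] by linarith
  qed (use p in blast)
qed

section \<open>Colourings of quotients of a tree\<close>

text \<open>An element with maximal \<open>d\<close> is nobody's parent, so its colour can be chosen
  last, avoiding one colour. Stated for a parent map on any set because it is applied to the cycles
  of an automorphism.\<close>

lemma card_rooted_colourings:
  fixes d :: "'b \<Rightarrow> nat"
  assumes "finite C" "R \<in> C" "\<And>A. A \<in> C \<Longrightarrow> A \<noteq> R \<Longrightarrow> p A \<in> C \<and> d (p A) < d A"
  shows "card {f \<in> C \<rightarrow>\<^sub>E {..<q::nat}. \<forall>A\<in>C - {R}. f A \<noteq> f (p A)} = q * (q - 1) ^ (card C - 1)"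
  using assms
proof (induction "card C" arbitrary: C rule: less_induct)
  case less
  let ?S = "\<lambda>C. {f \<in> C \<rightarrow>\<^sub>E {..<q}. \<forall>A\<in>C - {R}. f A \<noteq> f (p A)}"
  show ?case
  proof (cases "C = {R}")
    case True
    thus ?thesis by (simp add: card_funcsetE)
  next
    case False
    hence "C - {R} \<noteq> {}" "finite (C - {R})" using less.prems by auto
    hence "Max (d ` (C - {R})) \<in> d ` (C - {R})" "\<And>B. B \<in> C - {R} \<Longrightarrow> d B \<le> Max (d ` (C - {R}))"
      by simp_all
    then obtain A where "A \<in> C - {R}" "\<And>B. B \<in> C - {R} \<Longrightarrow> d B \<le> d A"
      by (metis (no_types, lifting) imageE)
    hence A: "A \<in> C" "A \<noteq> R" "\<And>B. B \<in> C - {R} \<Longrightarrow> d B \<le> d A" by auto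
    let ?D = "C - {A}"
    have D: "finite ?D" "R \<in> ?D" "A \<notin> ?D" "C = insert A ?D" "card C = Suc (card ?D)" "card ?D \<noteq> 0"
      using A less.prems by (auto simp: card_Suc_Diff1 simp del: card_Diff_insert)
    have pD: "p B \<in> ?D \<and> d (p B) < d B" if "B \<in> C" "B \<noteq> R" for B
      using less.prems(3)[OF that] A(3)[of B] that by auto
    have IH: "card (?S ?D) = q * (q - 1) ^ (card ?D - 1)"
      using less.hyps[of ?D] D pD by auto
    have pA: "p A \<in> ?D" using pD A by blast
    have "bij_betw (\<lambda>(f, i). f(A := i)) (SIGMA f : ?S ?D. {..<q} - {f (p A)}) (?S C)"
    proof (rule bij_betwI[where g = "\<lambda>f. (f(A := undefined), f A)"])
      show "(\<lambda>(f, i). f(A := i)) \<in> (SIGMA f : ?S ?D. {..<q} - {f (p A)}) \<rightarrow> ?S C"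
      proof (rule funcsetI)
        fix x assume "x \<in> (SIGMA f : ?S ?D. {..<q} - {f (p A)})"
        then obtain f i where x: "x = (f, i)" and f: "f \<in> ?D \<rightarrow>\<^sub>E {..<q}" "\<forall>A\<in>?D - {R}. f A \<noteq> f (p A)"
          and i: "i < q" "i \<noteq> f (p A)" by auto
        have "f(A := i) \<in> C \<rightarrow>\<^sub>E {..<q}" using f(1) i A(1) by (auto simp: PiE_def Pi_def extensional_def)
        moreover have "(f(A := i)) B \<noteq> (f(A := i)) (p B)" if "B \<in> C - {R}" for B
          using pD[of B] f(2) i that by auto
        ultimately show "(\<lambda>(f, i). f(A := i)) x \<in> ?S C" unfolding x by simp
      qed
      show "(\<lambda>f. (f(A := undefined), f A)) \<in> ?S C \<rightarrow> (SIGMA f : ?S ?D. {..<q} - {f (p A)})"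
      proof
        fix f assume f: "f \<in> ?S C"
        have "f(A := undefined) \<in> ?D \<rightarrow>\<^sub>E {..<q}" using f by (auto simp: PiE_def Pi_def extensional_def)
        moreover have "(f(A := undefined)) B \<noteq> (f(A := undefined)) (p B)" if "B \<in> ?D - {R}" for B
          using pD[of B] f that by auto
        moreover have "f A < q" "f A \<noteq> f (p A)" using f A by auto
        ultimately show "(f(A := undefined), f A) \<in> (SIGMA f : ?S ?D. {..<q} - {f (p A)})"
          using pA by auto
      qed
    next
      fix x assume x: "x \<in> (SIGMA f : ?S ?D. {..<q} - {f (p A)})"
      then obtain f i where fi: "x = (f, i)" "f A = undefined" using D(3) by (auto simp: PiE_def extensional_def)
      show "(\<lambda>f. (f(A := undefined), f A)) ((\<lambda>(f, i). f(A := i)) x) = x" using fi by auto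
    qed simp
    hence "card (?S C) = card (SIGMA f : ?S ?D. {..<q} - {f (p A)})"
      by (rule bij_betw_same_card[symmetric])
    also have "\<dots> = (\<Sum>f\<in>?S ?D. card ({..<q} - {f (p A)}))"
    proof (rule card_SigmaI)
      have "finite (?D \<rightarrow>\<^sub>E {..<q})" using D(1) by (simp add: finite_PiE)
      thus "finite (?S ?D)" by (rule finite_subset[rotated]) simp
    qed simp
    also have "\<dots> = (\<Sum>f\<in>?S ?D. q - 1)"
    proof (intro sum.cong refl)
      fix f assume "f \<in> ?S ?D"
      hence "f (p A) < q" using pA by auto
      thus "card ({..<q} - {f (p A)}) = q - 1" by simp
    qed
    also have "\<dots> = q * (q - 1) ^ (card ?D - 1) * (q - 1)"
      by (simp only: sum_constant IH of_nat_id)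
    also have "\<dots> = q * (q - 1) ^ (card C - 1)"
      unfolding D(5) using D(6) by (cases "card ?D") (simp_all only: diff_Suc_1 power_Suc ac_simps)
    finally show ?thesis .
  qed
qed

lemma mem_aut_group_iff: "g \<in> carrier (aut_group \<Gamma>) \<longleftrightarrow> g permutes pverts \<Gamma> \<and>
     (\<forall>u \<in> pverts \<Gamma>. \<forall>v \<in> pverts \<Gamma>. (g u, g v) \<in> parcs \<Gamma> \<longleftrightarrow> (u, v) \<in> parcs \<Gamma>)"
  by (simp add: aut_group_def)

lemma depth_automorphism:
  assumes "is_tree \<Gamma>" "g \<in> carrier (aut_group \<Gamma>)" "r \<in> pverts \<Gamma>" "v \<in> pverts \<Gamma>"
  shows "depth (parcs \<Gamma>) (g r) (g v) = depth (parcs \<Gamma>) r v"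
proof -
  note T = is_treeD[OF assms(1)]
  have perm: "g permutes pverts \<Gamma>" and aut: "\<And>u v. u \<in> pverts \<Gamma> \<Longrightarrow> v \<in> pverts \<Gamma> \<Longrightarrow> (g u, g v) \<in> parcs \<Gamma> \<longleftrightarrow> (u, v) \<in> parcs \<Gamma>"
    using assms(2) by (auto simp: mem_aut_group_iff)
  have "(g r, g v) \<in> parcs \<Gamma> ^^ m \<longleftrightarrow> (r, v) \<in> parcs \<Gamma> ^^ m" for m
    using assms(4)
  proof (induction m arbitrary: v)
    case 0
    thus ?case using perm by (auto dest: permutes_inj[THEN injD])
  next
    case (Suc m)
    show ?case
    proof
      assume "(g r, g v) \<in> parcs \<Gamma> ^^ Suc m"
      then obtain w where w: "(g r, w) \<in> parcs \<Gamma> ^^ m" "(w, g v) \<in> parcs \<Gamma>" by auto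
      have "w \<in> pverts \<Gamma>" using w T(3) by blast
      then obtain u where "u \<in> pverts \<Gamma>" "w = g u" using permutes_image[OF perm] by blast
      thus "(r, v) \<in> parcs \<Gamma> ^^ Suc m" using w Suc aut by auto
    next
      assume "(r, v) \<in> parcs \<Gamma> ^^ Suc m"
      then obtain w where w: "(r, w) \<in> parcs \<Gamma> ^^ m" "(w, v) \<in> parcs \<Gamma>" by auto
      have "w \<in> pverts \<Gamma>" using w T(3) by blast
      thus "(g r, g v) \<in> parcs \<Gamma> ^^ Suc m" using w Suc aut by auto
    qed
  qed
  thus ?thesis by (simp add: depth_def)
qed

text \<open>Rooting the tree at the fixed vertex makes depth and parenthood compatible with
  \<open>g\<close>. Both descend to cycles, and the edges of the quotient are exactly its parent
  edges.\<close>

lemma chromatic_poly_quotient_graph: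
  assumes tree: "is_tree \<Gamma>" and aut: "g \<in> carrier (aut_group \<Gamma>)" and r: "r \<in> pverts \<Gamma>" "g r = r"
  shows "chromatic_poly (quotient_graph \<Gamma> g) =
    [:0, 1:] * [:-1, 1:] ^ (card (perm_cycles (pverts \<Gamma>) g) - 1)"
proof (rule poly_eq_if_eq_on_nats)
  fix q :: nat
  let ?V = "pverts \<Gamma>" and ?C = "perm_cycles (pverts \<Gamma>) g"
  note T = is_treeD[OF tree]
  have perm: "g permutes ?V" and arcs: "\<And>u v. u \<in> ?V \<Longrightarrow> v \<in> ?V \<Longrightarrow> (g u, g v) \<in> parcs \<Gamma> \<longleftrightarrow> (u, v) \<in> parcs \<Gamma>"
    using aut by (auto simp: mem_aut_group_iff)
  define d where "d = depth (parcs \<Gamma>) r"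
  have dg: "d (g v) = d v" if "v \<in> ?V" for v
    using depth_automorphism[OF tree aut r(1) that] r(2) by (simp add: d_def)
  obtain p where p: "\<And>v. v \<in> ?V \<Longrightarrow> v \<noteq> r \<Longrightarrow> (p v, v) \<in> parcs \<Gamma> \<and> d (p v) < d v"
    and p': "\<And>u v. (u, v) \<in> parcs \<Gamma> \<Longrightarrow> u \<noteq> r \<and> p u = v \<or> v \<noteq> r \<and> p v = u"
    by (rule tree_parent[OF tree r(1), folded d_def]) blast
  have gr: "g v = r \<longleftrightarrow> v = r" for v using perm r(2) by (metis permutes_inj injD)
  have gV: "g v \<in> ?V \<longleftrightarrow> v \<in> ?V" for v using perm by (simp add: permutes_in_image)
  \<comment> \<open>\<open>g (p v)\<close> is a neighbour of \<open>g v\<close> and shallower, so it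
    must be its parent.\<close>
  have pg: "p (g v) = g (p v)" if v: "v \<in> ?V" "v \<noteq> r" for v
  proof -
    have pv: "p v \<in> ?V" "(p v, v) \<in> parcs \<Gamma>" "d (p v) < d v" using p[OF v] T(3) by blast+
    hence "(g (p v), g v) \<in> parcs \<Gamma>" using arcs v by simp
    moreover have "d (g (p v)) < d (g v)" using dg pv v by simp
    ultimately show ?thesis using p'[of "g (p v)" "g v"] p[of "g (p v)"] pv gV by auto
  qed
  \<comment> \<open>Along a cycle the depth is constant and the parents stay in a single cycle, so
    \<open>\<pi>\<close> and \<open>\<delta>\<close> below do not depend on the chosen
    representative.\<close>
  have orb: "x \<in> orbit g v \<Longrightarrow> x \<in> ?V \<and> x \<noteq> r \<and> d x = d v \<and> p x \<in> orbit g (p v)"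
    if v: "v \<in> ?V" "v \<noteq> r" for x v
  proof (induction rule: orbit.induct)
    case base
    show ?case using v gr gV dg pg orbit.base[of g "p v"] by simp
  next
    case (step y)
    thus ?case using v gr gV dg pg orbit.step[of "p y" g "p v"] by simp
  qed
  let ?R = "orbit g r"
  have R: "?R = {r}" using r(2) by (simp add: orbit_eq_singleton_iff)
  define \<pi> where "\<pi> B = orbit g (p (SOME x. x \<in> B))" for B
  define \<delta> where "\<delta> B = d (SOME x. x \<in> B)" for B
  have some: "(SOME x. x \<in> B) \<in> B" if "B \<in> ?C" for B
    using that orbit_nonempty[of g] by (auto simp: perm_cycles_def some_in_eq)
  note memD = perm_cycles_memD[OF T(1) perm]
  have mem: "orbit g v \<in> ?C" if "v \<in> ?V" for v using that by (simp add: perm_cycles_def)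
  note self = self_in_orbit_permutes[OF T(1) perm]
  have pi: "\<pi> (orbit g v) = orbit g (p v)" "\<delta> (orbit g v) = d v" if v: "v \<in> ?V" "v \<noteq> r" for v
  proof -
    have s: "(SOME x. x \<in> orbit g v) \<in> orbit g v" using some mem v by blast
    have "p v \<in> ?V" using p[OF v] T(3) by blast
    thus "\<pi> (orbit g v) = orbit g (p v)"
      using memD(2)[OF mem, of "p v"] orb[OF v s] unfolding \<pi>_def by metis
    show "\<delta> (orbit g v) = d v" using orb[OF v s] unfolding \<delta>_def by metis
  qed
  have dR: "\<delta> ?R = d r" by (simp add: \<delta>_def R)
  have key: "\<pi> B \<in> ?C \<and> \<delta> (\<pi> B) < \<delta> B" if B: "B \<in> ?C" "B \<noteq> ?R" for B
  proof -
    obtain v where v: "v \<in> ?V" "B = orbit g v" "v \<noteq> r" using B by (auto simp: perm_cycles_def)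
    have pv: "p v \<in> ?V" "d (p v) < d v" using p[OF v(1,3)] T(3) by blast+
    have "\<delta> (orbit g (p v)) = d (p v)" using pi(2)[OF pv(1)] dR by (cases "p v = r") auto
    thus ?thesis using pi[OF v(1,3)] v pv mem by simp
  qed
  have adj: "(B, B') \<in> parcs (quotient_graph \<Gamma> g) \<longleftrightarrow>
      B \<in> ?C \<and> B' \<in> ?C \<and> (B \<noteq> ?R \<and> \<pi> B = B' \<or> B' \<noteq> ?R \<and> \<pi> B' = B)" for B B'
  proof
    assume "(B, B') \<in> parcs (quotient_graph \<Gamma> g)"
    then obtain u v where uv: "B \<in> ?C" "B' \<in> ?C" "u \<in> B" "v \<in> B'" "(u, v) \<in> parcs \<Gamma>"
      by (auto simp: quotient_graph_def)
    have B: "B = orbit g u" "B' = orbit g v" "u \<in> ?V" "v \<in> ?V" using memD uv by auto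
    have neR: "orbit g w \<noteq> ?R" if "w \<noteq> r" for w using self[of w] that R by auto
    show "B \<in> ?C \<and> B' \<in> ?C \<and> (B \<noteq> ?R \<and> \<pi> B = B' \<or> B' \<noteq> ?R \<and> \<pi> B' = B)"
      using p'[OF uv(5)] uv B pi neR by metis
  next
    have *: "\<exists>u\<in>B. (p u, u) \<in> parcs \<Gamma> \<and> p u \<in> \<pi> B" if B: "B \<in> ?C" "B \<noteq> ?R" for B
    proof -
      obtain v where v: "v \<in> ?V" "B = orbit g v" "v \<noteq> r" using B by (auto simp: perm_cycles_def)
      thus ?thesis using p pi(1)[of v] self by metis
    qed
    assume "B \<in> ?C \<and> B' \<in> ?C \<and> (B \<noteq> ?R \<and> \<pi> B = B' \<or> B' \<noteq> ?R \<and> \<pi> B' = B)"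
    thus "(B, B') \<in> parcs (quotient_graph \<Gamma> g)"
      using *[of B] *[of B'] T(4) by (fastforce simp: quotient_graph_def)
  qed
  have "proper_colourings (quotient_graph \<Gamma> g) q =
      {f \<in> ?C \<rightarrow>\<^sub>E {..<q}. \<forall>B\<in>?C - {?R}. f B \<noteq> f (\<pi> B)}"
  proof -
    have "(\<forall>(B, B')\<in>parcs (quotient_graph \<Gamma> g). f B \<noteq> f B') \<longleftrightarrow> (\<forall>B\<in>?C - {?R}. f B \<noteq> f (\<pi> B))" for f :: "'a set \<Rightarrow> nat"
    proof (intro iffI ballI)
      fix B assume *: "\<forall>(B, B')\<in>parcs (quotient_graph \<Gamma> g). f B \<noteq> f B'" and B: "B \<in> ?C - {?R}"
      have "(B, \<pi> B) \<in> parcs (quotient_graph \<Gamma> g)" using adj[of B "\<pi> B"] key[of B] B by blast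
      thus "f B \<noteq> f (\<pi> B)" using * by blast
    next
      fix e assume *: "\<forall>B\<in>?C - {?R}. f B \<noteq> f (\<pi> B)" and e: "e \<in> parcs (quotient_graph \<Gamma> g)"
      obtain B B' where BB: "e = (B, B')" by fastforce
      have "B \<in> ?C - {?R} \<and> \<pi> B = B' \<or> B' \<in> ?C - {?R} \<and> \<pi> B' = B"
        using adj[of B B'] e unfolding BB by blast
      thus "case e of (B, B') \<Rightarrow> f B \<noteq> f B'"
        unfolding BB prod.case using *[rule_format, of B] *[rule_format, of B'] by metis
    qed
    thus ?thesis by (auto simp: proper_colourings_def quotient_graph_def)
  qed
  hence card: "card (proper_colourings (quotient_graph \<Gamma> g) q) = q * (q - 1) ^ (card ?C - 1)"
    using card_rooted_colourings[of ?C ?R \<pi> \<delta> q] key finite_perm_cycles[OF T(1)] mem[OF r(1)] by simp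
  have "poly (chromatic_poly (quotient_graph \<Gamma> g)) (real q) = real (q * (q - 1) ^ (card ?C - 1))"
    using poly_chromatic_poly_quotient_graph[OF T(1)] card by metis
  \<comment> \<open>The natural number \<open>q - 1\<close> is truncated at \<open>q = 0\<close>,
    where the factor \<open>q\<close> makes both sides vanish.\<close>
  thus "poly (chromatic_poly (quotient_graph \<Gamma> g)) (real q) = poly ([:0, 1:] * [:-1, 1:] ^ (card ?C - 1)) (real q)"
    by (cases q) (simp_all add: algebra_simps)
qed

text \<open>If the degree exceeded \<open>c\<close>, subtracting \<open>x ^ c\<close> would keep the
  leading coefficient; a positive one violates the upper bound for large \<open>q\<close>, a
  negative one the lower bound.\<close>

lemma poly_le_power_imp_degree_le:
  fixes P :: "real poly"
  assumes "\<And>q::nat. 0 \<le> poly P (real q)" "\<And>q::nat. poly P (real q) \<le> real q ^ c"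
  shows "degree P \<le> c"
proof (rule ccontr)
  assume deg: "\<not> degree P \<le> c"
  hence "lead_coeff P \<noteq> 0" by auto
  then consider "lead_coeff P > 0" | "lead_coeff (- P) > 0" by fastforce
  thus False
  proof cases
    case 1
    let ?Q = "P + monom (-1) c"
    have "degree ?Q = degree P"
      using deg by (intro degree_add_eq_left) (simp add: degree_monom_eq)
    hence lc: "lead_coeff ?Q = lead_coeff P" using deg by simp
    then obtain N where "\<And>x. x \<ge> N \<Longrightarrow> poly ?Q x \<ge> lead_coeff ?Q"
      using 1 poly_pinfty_gt_lc[of ?Q] by auto
    moreover obtain q where "real q \<ge> N" using real_arch_simple by blast
    ultimately have "poly ?Q (real q) > 0" using 1 lc by (metis less_le_trans)
    thus False using assms(2)[of q] by (simp add: poly_monom)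
  next
    case 2
    then obtain N where "\<And>x. x \<ge> N \<Longrightarrow> poly (-P) x \<ge> lead_coeff (-P)"
      using poly_pinfty_gt_lc[of "-P"] by auto
    moreover obtain q where "real q \<ge> N" using real_arch_simple by blast
    ultimately have "poly (-P) (real q) > 0" using 2 by (metis less_le_trans)
    thus False using assms(1)[of q] by simp
  qed
qed

lemma degree_chromatic_poly_quotient_graph_le:
  assumes "finite (pverts \<Gamma>)"
  shows "degree (chromatic_poly (quotient_graph \<Gamma> g)) \<le> card (perm_cycles (pverts \<Gamma>) g)"
proof (rule poly_le_power_imp_degree_le)
  fix q :: nat
  note P = poly_chromatic_poly_quotient_graph[OF assms, of g q]
  show "0 \<le> poly (chromatic_poly (quotient_graph \<Gamma> g)) (real q)" unfolding P by simp
  have "card (proper_colourings (quotient_graph \<Gamma> g) q) \<le> card (perm_cycles (pverts \<Gamma>) g \<rightarrow>\<^sub>E {..<q})"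
    using finite_perm_cycles[OF assms, of g]
    by (intro card_mono finite_PiE) (auto simp: proper_colourings_def quotient_graph_def)
  also have "\<dots> = q ^ card (perm_cycles (pverts \<Gamma>) g)"
    using finite_perm_cycles[OF assms, of g] by (simp add: card_funcsetE)
  finally show "poly (chromatic_poly (quotient_graph \<Gamma> g)) (real q) \<le> real q ^ card (perm_cycles (pverts \<Gamma>) g)"
    unfolding P by (metis of_nat_le_iff of_nat_power)
qed

section \<open>Counting invariant colourings over a permutation group\<close>

text \<open>Groups are kept as plain sets of functions so that one and the same \<open>G\<close> can
  act both on all vertices and on the leaves of a star.\<close>

locale perm_group =
  fixes A :: "'a set" and G :: "('a \<Rightarrow> 'a) set"
  assumes finite_points: "finite A"
    and permutes: "g \<in> G \<Longrightarrow> g permutes A"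
    and id_mem: "id \<in> G"
    and comp_mem: "g \<in> G \<Longrightarrow> h \<in> G \<Longrightarrow> g \<circ> h \<in> G"
    and inv_mem: "g \<in> G \<Longrightarrow> inv_into UNIV g \<in> G"
begin

lemma finite_group: "finite G"
  using finite_subset[OF _ finite_permutations[OF finite_points]] permutes by blast

lemma mem_iff: "g \<in> G \<Longrightarrow> g x \<in> A \<longleftrightarrow> x \<in> A"
  using permutes_in_image[OF permutes] by blast

lemma transposed_points:
  assumes "transpose a b \<in> G" "a \<noteq> b"
  shows "a \<in> A \<and> b \<in> A"
  using permutes_not_in[OF permutes[OF assms(1)]] assms(2)
  by (metis transpose_apply_first transpose_apply_second)

lemma transpose_conjugate_mem:
  assumes "g \<in> G" "transpose a b \<in> G"
  shows "transpose (g a) (g b) \<in> G"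
proof -
  have bij: "bij g" using permutes[OF assms(1)] by (rule permutes_bij)
  have "transpose (g a) (g b) \<circ> g = g \<circ> transpose a b"
    using bij by (simp add: transpose_comp_eq bij_is_inj)
  hence "transpose (g a) (g b) \<circ> (g \<circ> inv_into UNIV g) = g \<circ> transpose a b \<circ> inv_into UNIV g"
    by (simp only: comp_assoc[symmetric])
  hence "transpose (g a) (g b) = g \<circ> transpose a b \<circ> inv_into UNIV g"
    using permutes_inv_o(1)[OF permutes[OF assms(1)]] by simp
  thus ?thesis using assms comp_mem inv_mem by auto
qed

text \<open>Burnside's lemma on each fibre of \<open>key\<close>: the stabiliser of a type acts transitively on the
  colourings of that type.\<close>
lemma sum_card_fixed_by_type:
  fixes Y :: "('a \<Rightarrow> 'b) set" and key :: "('a \<Rightarrow> 'b) \<Rightarrow> ('a \<Rightarrow> 'c)"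
  assumes fin: "finite Y" "finite K" and K: "key ` Y = K"
    and ext: "\<And>f. f \<in> Y \<Longrightarrow> f \<in> extensional A" "\<And>\<tau>. \<tau> \<in> K \<Longrightarrow> \<tau> \<in> extensional A"
    and act: "\<And>f g. f \<in> Y \<Longrightarrow> g \<in> G \<Longrightarrow> (\<lambda>x\<in>A. f (g x)) \<in> Y"
    and equivariant: "\<And>f g x. f \<in> Y \<Longrightarrow> g \<in> G \<Longrightarrow> x \<in> A \<Longrightarrow> key (\<lambda>x\<in>A. f (g x)) x = key f (g x)"
    and transitive: "\<And>f f'. f \<in> Y \<Longrightarrow> f' \<in> Y \<Longrightarrow> key f = key f' \<Longrightarrow> \<exists>g\<in>G. \<forall>x\<in>A. f (g x) = f' x"
  shows "(\<Sum>g\<in>G. card {f\<in>Y. \<forall>x\<in>A. f (g x) = f x}) = (\<Sum>\<tau>\<in>K. card {g\<in>G. \<forall>x\<in>A. \<tau> (g x) = \<tau> x})"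
proof -
  let ?St = "\<lambda>f. {g\<in>G. \<forall>x\<in>A. f (g x) = f x}"
  have fibre: "(\<Sum>f | f \<in> Y \<and> key f = \<tau>. card (?St f)) = card {g\<in>G. \<forall>x\<in>A. \<tau> (g x) = \<tau> x}" if tau: "\<tau> \<in> K" for \<tau>
  proof -
    obtain f0 where f0: "f0 \<in> Y" "key f0 = \<tau>" using tau K by blast
    \<comment> \<open>The elements carrying \<open>f0\<close> to \<open>f\<close>. Each such set is
      a coset of the stabiliser of \<open>f\<close>, and together they partition the stabiliser of
      \<open>\<tau>\<close>.\<close>
    let ?Tr = "\<lambda>f. {g\<in>G. \<forall>x\<in>A. f0 (g x) = f x}"
    have card_Tr: "card (?Tr f) = card (?St f)" if f: "f \<in> Y" "key f = \<tau>" for f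
    proof -
      obtain h where h: "h \<in> G" "\<forall>x\<in>A. f0 (h x) = f x" using transitive[of f0 f] f0 f by auto
      note hi = permutes_inverses[OF permutes[OF h(1)]]
      have "bij_betw (\<lambda>k. h \<circ> k) (?St f) (?Tr f)"
      proof (rule bij_betwI[where g = "\<lambda>k. inv_into UNIV h \<circ> k"])
        show "(\<lambda>k. h \<circ> k) \<in> ?St f \<rightarrow> ?Tr f" using h comp_mem mem_iff by auto
        show "(\<lambda>k. inv_into UNIV h \<circ> k) \<in> ?Tr f \<rightarrow> ?St f"
        proof
          fix k assume k: "k \<in> ?Tr f"
          have "f (inv_into UNIV h (k x)) = f x" if "x \<in> A" for x
          proof -
            have "inv_into UNIV h (k x) \<in> A" using k that inv_mem[OF h(1)] mem_iff by simp
            hence "f (inv_into UNIV h (k x)) = f0 (k x)" using h(2) hi(1) by metis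
            thus ?thesis using k that by simp
          qed
          thus "inv_into UNIV h \<circ> k \<in> ?St f" using k comp_mem inv_mem h(1) by simp
        qed
      qed (auto simp: hi fun_eq_iff)
      thus ?thesis using bij_betw_same_card by fastforce
    qed
    have "{g\<in>G. \<forall>x\<in>A. \<tau> (g x) = \<tau> x} = (\<Union>f\<in>{f \<in> Y. key f = \<tau>}. ?Tr f)"
    proof (intro equalityI subsetI)
      fix g assume g: "g \<in> {g\<in>G. \<forall>x\<in>A. \<tau> (g x) = \<tau> x}"
      let ?f = "\<lambda>x\<in>A. f0 (g x)"
      have Y: "?f \<in> Y" using act f0 g by blast
      hence "key ?f \<in> extensional A" "\<tau> \<in> extensional A" using K ext(2) tau by auto
      hence "key ?f = \<tau>"
        by (rule extensionalityI) (use equivariant[of f0 g] f0 g in auto)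
      thus "g \<in> (\<Union>f\<in>{f \<in> Y. key f = \<tau>}. ?Tr f)" using Y g by (intro UN_I[of ?f]) auto
    next
      fix g assume "g \<in> (\<Union>f\<in>{f \<in> Y. key f = \<tau>}. ?Tr f)"
      then obtain f where f: "f \<in> Y" "key f = \<tau>" "g \<in> G" "\<forall>x\<in>A. f0 (g x) = f x" by blast
      have "(\<lambda>x\<in>A. f0 (g x)) = f"
        by (rule extensionalityI[of _ A]) (use f ext(1) in auto)
      hence "\<tau> (g x) = \<tau> x" if "x \<in> A" for x
        using equivariant[OF f0(1) f(3) that] f f0 by simp
      thus "g \<in> {g\<in>G. \<forall>x\<in>A. \<tau> (g x) = \<tau> x}" using f by simp
    qed
    also have "card \<dots> = (\<Sum>f | f \<in> Y \<and> key f = \<tau>. card (?Tr f))"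
    proof (rule card_UN_disjoint)
      show "\<forall>f\<in>{f \<in> Y. key f = \<tau>}. \<forall>f'\<in>{f \<in> Y. key f = \<tau>}. f \<noteq> f' \<longrightarrow> ?Tr f \<inter> ?Tr f' = {}"
      proof (intro ballI impI, rule ccontr)
        fix f f' assume f: "f \<in> {f \<in> Y. key f = \<tau>}" "f' \<in> {f \<in> Y. key f = \<tau>}" "f \<noteq> f'" "?Tr f \<inter> ?Tr f' \<noteq> {}"
        hence "\<forall>x\<in>A. f x = f' x" by auto
        thus False using f ext(1) extensionalityI[of f A f'] by blast
      qed
    qed (use fin finite_group in auto)
    also have "\<dots> = (\<Sum>f | f \<in> Y \<and> key f = \<tau>. card (?St f))"
      by (intro sum.cong refl) (use card_Tr in auto)
    finally show ?thesis by simp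
  qed
  have "(\<Sum>g\<in>G. card {f\<in>Y. \<forall>x\<in>A. f (g x) = f x}) = (\<Sum>f\<in>Y. card (?St f))"
    using sum.swap_restrict[OF finite_group fin(1), of "\<lambda>_ _. 1::nat" "\<lambda>g f. \<forall>x\<in>A. f (g x) = f x"] by simp
  also have "\<dots> = (\<Sum>\<tau>\<in>K. \<Sum>f | f \<in> Y \<and> key f = \<tau>. card (?St f))"
    by (rule sum.group[symmetric, OF fin]) (use K in auto)
  also have "\<dots> = (\<Sum>\<tau>\<in>K. card {g\<in>G. \<forall>x\<in>A. \<tau> (g x) = \<tau> x})"
    using fibre by (intro sum.cong) auto
  finally show ?thesis .
qed

end

section \<open>Groups between \<open>(C_2)^k\<close> and \<open>C_2 wr S_k\<close>\<close>

text \<open>The pairing is encoded as a fixed-point-free involution; \<open>commute\<close> is the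
  upper bound on \<open>G\<close>, \<open>swap_mem\<close> the lower bound.\<close>

locale paired_perm_group = perm_group +
  fixes \<sigma> :: "'a \<Rightarrow> 'a"
  assumes partner: "x \<in> A \<Longrightarrow> \<sigma> x \<in> A" "x \<in> A \<Longrightarrow> \<sigma> x \<noteq> x" "x \<in> A \<Longrightarrow> \<sigma> (\<sigma> x) = x"
    and commute: "g \<in> G \<Longrightarrow> x \<in> A \<Longrightarrow> g (\<sigma> x) = \<sigma> (g x)"
    and swap_mem: "x \<in> A \<Longrightarrow> transpose x (\<sigma> x) \<in> G"
begin

text \<open>The swaps act on the pairs independently, so pairs on which the colourings disagree can
  be corrected one at a time.\<close>

lemma swaps_transitive:
  assumes "\<And>x. x \<in> A \<Longrightarrow> f x = f' x \<and> f (\<sigma> x) = f' (\<sigma> x) \<or> f x = f' (\<sigma> x) \<and> f (\<sigma> x) = f' x"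
  shows "\<exists>g\<in>G. \<forall>x\<in>A. f (g x) = f' x"
  using assms
proof (induction "card {x\<in>A. f x \<noteq> f' x}" arbitrary: f rule: less_induct)
  case less
  show ?case
  proof (cases "\<forall>x\<in>A. f x = f' x")
    case True
    thus ?thesis using id_mem by (intro bexI[of _ id]) auto
  next
    case False
    then obtain a where a: "a \<in> A" "f a \<noteq> f' a" by blast
    let ?t = "transpose a (\<sigma> a)"
    let ?f = "f \<circ> ?t"
    note p = partner[OF a(1)]
    have fa: "f a = f' (\<sigma> a)" "f (\<sigma> a) = f' a" using less.prems[OF a(1)] a(2) by auto
    have t: "?t x = x" "?t (\<sigma> x) = \<sigma> x" if "x \<in> A" "x \<noteq> a" "x \<noteq> \<sigma> a" for x
      using that p partner(3)[of x] by (metis transpose_apply_other)+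
    have "{x\<in>A. ?f x \<noteq> f' x} \<subset> {x\<in>A. f x \<noteq> f' x}"
    proof
      show "{x\<in>A. ?f x \<noteq> f' x} \<subseteq> {x\<in>A. f x \<noteq> f' x}"
      proof
        fix x assume x: "x \<in> {x\<in>A. ?f x \<noteq> f' x}"
        hence "x \<noteq> a" "x \<noteq> \<sigma> a" using fa by auto
        thus "x \<in> {x\<in>A. f x \<noteq> f' x}" using x t(1) by auto
      qed
      have "a \<in> {x\<in>A. f x \<noteq> f' x}" "a \<notin> {x\<in>A. ?f x \<noteq> f' x}" using a fa by auto
      thus "{x\<in>A. ?f x \<noteq> f' x} \<noteq> {x\<in>A. f x \<noteq> f' x}" by blast
    qed
    hence "card {x\<in>A. ?f x \<noteq> f' x} < card {x\<in>A. f x \<noteq> f' x}"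
      using finite_points by (intro psubset_card_mono) auto
    moreover have "?f x = f' x \<and> ?f (\<sigma> x) = f' (\<sigma> x) \<or> ?f x = f' (\<sigma> x) \<and> ?f (\<sigma> x) = f' x" if x: "x \<in> A" for x
    proof (cases "x = a \<or> x = \<sigma> a")
      case True
      thus ?thesis using fa p by auto
    next
      case False
      thus ?thesis using t[OF x] less.prems[OF x] by auto
    qed
    ultimately obtain g where g: "g \<in> G" "\<forall>x\<in>A. ?f (g x) = f' x" using less.hyps[of ?f] by blast
    thus ?thesis using comp_mem[OF swap_mem[OF a(1)] g(1)] by (intro bexI[of _ "?t \<circ> g"]) auto
  qed
qed

text \<open>The type of a colouring records the unordered pair of colours on each pair of points. Shifting the
  larger colour by one (\<open>s = Suc\<close>) gives arbitrary colourings with \<open>q - 1\<close> colours the same types as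
  colourings with \<open>q\<close> colours that separate partners (\<open>s = id\<close>).\<close>
definition types :: "nat \<Rightarrow> ('a \<Rightarrow> nat \<times> nat) set" where
  "types q = {\<tau> \<in> A \<rightarrow>\<^sub>E {(a, b). a < b \<and> b < q}. \<forall>x\<in>A. \<tau> (\<sigma> x) = \<tau> x}"

definition type_of :: "(nat \<Rightarrow> nat) \<Rightarrow> ('a \<Rightarrow> nat) \<Rightarrow> 'a \<Rightarrow> nat \<times> nat" where
  "type_of s f = (\<lambda>x\<in>A. (min (f x) (f (\<sigma> x)), s (max (f x) (f (\<sigma> x)))))"

lemma finite_types: "finite (types q)"
proof -
  have "finite {(a, b). a < b \<and> b < q}"
    by (rule finite_subset[of _ "{..<q} \<times> {..<q}"]) auto
  hence "finite (A \<rightarrow>\<^sub>E {(a, b). a < b \<and> b < q})" using finite_points by (simp add: finite_PiE)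
  thus ?thesis unfolding types_def by (rule finite_subset[rotated]) auto
qed

text \<open>The right-hand side mentions neither \<open>Y\<close> nor \<open>s\<close>, so two
  instances equate the counts for two different families of colourings.\<close>

lemma sum_card_fixed_types:
  assumes Y: "finite Y" "Y \<subseteq> extensional A" "type_of s ` Y = types q" and s: "inj s"
    and act: "\<And>f g. f \<in> Y \<Longrightarrow> g \<in> G \<Longrightarrow> (\<lambda>x\<in>A. f (g x)) \<in> Y"
  shows "(\<Sum>g\<in>G. card {f\<in>Y. \<forall>x\<in>A. f (g x) = f x}) = (\<Sum>\<tau>\<in>types q. card {g\<in>G. \<forall>x\<in>A. \<tau> (g x) = \<tau> x})"
proof (rule sum_card_fixed_by_type[OF Y(1) finite_types Y(3)])
  show "(\<lambda>x\<in>A. f (g x)) \<in> Y" if "f \<in> Y" "g \<in> G" for f g using act that .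
  show "type_of s (\<lambda>x\<in>A. f (g x)) x = type_of s f (g x)" if "f \<in> Y" "g \<in> G" "x \<in> A" for f g x
    using that partner(1) commute mem_iff by (simp add: type_of_def)
  show "\<exists>g\<in>G. \<forall>x\<in>A. f (g x) = f' x" if f: "f \<in> Y" "f' \<in> Y" "type_of s f = type_of s f'" for f f'
  proof (rule swaps_transitive)
    fix x assume x: "x \<in> A"
    \<comment> \<open>As \<open>s\<close> is injective, equal types mean equal minima and maxima,
      that is, equal unordered colour pairs.\<close>
    have "type_of s f x = type_of s f' x" using f(3) by simp
    hence "min (f x) (f (\<sigma> x)) = min (f' x) (f' (\<sigma> x))" "max (f x) (f (\<sigma> x)) = max (f' x) (f' (\<sigma> x))"
      using x s by (auto simp: type_of_def dest: injD)
    thus "f x = f' x \<and> f (\<sigma> x) = f' (\<sigma> x) \<or> f x = f' (\<sigma> x) \<and> f (\<sigma> x) = f' x"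
      by (auto simp: min_def max_def split: if_splits)
  qed
qed (use Y(2) in \<open>auto simp: types_def PiE_def\<close>)

text \<open>Singles out one point of each pair, the one with the smaller label; it decides which
  partner gets the smaller colour when a colouring is built from a type.\<close>

lemma orientation:
  obtains e :: "'a \<Rightarrow> nat" where "\<And>x. x \<in> A \<Longrightarrow> e (\<sigma> x) \<noteq> e x"
proof -
  obtain e :: "'a \<Rightarrow> nat" where "inj_on e A" using finite_imp_inj_to_nat_seg[OF finite_points] by blast
  thus thesis using that[of e] partner by (metis inj_onD)
qed

definition strict_colourings :: "nat \<Rightarrow> ('a \<Rightarrow> nat) set" where
  "strict_colourings q = {f \<in> A \<rightarrow>\<^sub>E {..<q}. \<forall>x\<in>A. f x \<noteq> f (\<sigma> x)}"

lemma type_of_weak_colourings: "type_of Suc ` (A \<rightarrow>\<^sub>E {..<q - 1}) = types q"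
proof (intro equalityI subsetI)
  fix \<tau> assume "\<tau> \<in> type_of Suc ` (A \<rightarrow>\<^sub>E {..<q - 1})"
  then obtain f where f: "f \<in> A \<rightarrow>\<^sub>E {..<q - 1}" "\<tau> = type_of Suc f" by blast
  have "f x < q - 1 \<and> f (\<sigma> x) < q - 1" if "x \<in> A" for x using f(1) partner(1)[OF that] that by auto
  thus "\<tau> \<in> types q" using partner(1,3)
    by (fastforce simp: f(2) types_def type_of_def min.commute max.commute min_def max_def)
next
  fix \<tau> assume tau: "\<tau> \<in> types q"
  obtain e :: "'a \<Rightarrow> nat" where e: "\<And>x. x \<in> A \<Longrightarrow> e (\<sigma> x) \<noteq> e x" using orientation by blast
  \<comment> \<open>Subtracting 1 from the larger entry undoes the \<open>Suc\<close> in the type.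
    The pair is strict, so the result is still at least the smaller entry.\<close>
  define f where "f = (\<lambda>x\<in>A. if e x < e (\<sigma> x) then fst (\<tau> x) else snd (\<tau> x) - 1)"
  have T: "fst (\<tau> x) < snd (\<tau> x)" "snd (\<tau> x) < q" "\<tau> (\<sigma> x) = \<tau> x" if "x \<in> A" for x
    using tau that by (auto simp: types_def PiE_def Pi_def case_prod_beta)
  have "f \<in> A \<rightarrow>\<^sub>E {..<q - 1}" using T(1,2) by (fastforce simp: f_def)
  moreover have "\<tau> = type_of Suc f"
  proof (rule extensionalityI[of _ A])
    fix x assume x: "x \<in> A"
    have "e x < e (\<sigma> x) \<longleftrightarrow> \<not> e (\<sigma> x) < e (\<sigma> (\<sigma> x))" using e[OF x] partner(3)[OF x] by auto
    thus "\<tau> x = type_of Suc f x" using T[OF x] x partner(1)[OF x]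
      by (auto simp: f_def type_of_def min_def max_def prod_eq_iff)
  qed (use tau in \<open>auto simp: types_def type_of_def PiE_def\<close>)
  ultimately show "\<tau> \<in> type_of Suc ` (A \<rightarrow>\<^sub>E {..<q - 1})" by blast
qed

lemma type_of_strict_colourings: "type_of id ` strict_colourings q = types q"
proof (intro equalityI subsetI)
  fix \<tau> assume "\<tau> \<in> type_of id ` strict_colourings q"
  then obtain f where f: "f \<in> strict_colourings q" "\<tau> = type_of id f" by blast
  have "f x < q \<and> f (\<sigma> x) < q \<and> f x \<noteq> f (\<sigma> x)" if "x \<in> A" for x
    using f(1) partner(1)[OF that] that by (auto simp: strict_colourings_def)
  thus "\<tau> \<in> types q" using partner(1,3)
    by (fastforce simp: f(2) types_def type_of_def min.commute max.commute min_def max_def)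
next
  fix \<tau> assume tau: "\<tau> \<in> types q"
  obtain e :: "'a \<Rightarrow> nat" where e: "\<And>x. x \<in> A \<Longrightarrow> e (\<sigma> x) \<noteq> e x" using orientation by blast
  define f where "f = (\<lambda>x\<in>A. if e x < e (\<sigma> x) then fst (\<tau> x) else snd (\<tau> x))"
  have T: "fst (\<tau> x) < snd (\<tau> x)" "snd (\<tau> x) < q" "\<tau> (\<sigma> x) = \<tau> x" if "x \<in> A" for x
    using tau that by (auto simp: types_def PiE_def Pi_def case_prod_beta)
  have flip: "e x < e (\<sigma> x) \<longleftrightarrow> \<not> e (\<sigma> x) < e (\<sigma> (\<sigma> x))" if x: "x \<in> A" for x
    using e[OF x] partner(3)[OF x] by auto
  have "f x < q" if "x \<in> A" for x using T(1,2)[OF that] that by (auto simp: f_def)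
  moreover have "f x \<noteq> f (\<sigma> x)" if x: "x \<in> A" for x
    using T(1,3)[OF x] flip[OF x] partner(1)[OF x] x by (auto simp: f_def)
  ultimately have "f \<in> strict_colourings q" by (auto simp: strict_colourings_def f_def)
  moreover have "\<tau> = type_of id f"
  proof (rule extensionalityI[of _ A])
    fix x assume x: "x \<in> A"
    show "\<tau> x = type_of id f x" using flip[OF x] T[OF x] x partner(1)[OF x]
      by (auto simp: f_def type_of_def min_def max_def prod_eq_iff)
  qed (use tau in \<open>auto simp: types_def type_of_def PiE_def\<close>)
  ultimately show "\<tau> \<in> type_of id ` strict_colourings q" by blast
qed

text \<open>A group element preserving a strict colouring preserves the set of points coloured smaller than
  their partners, so \<open>\<sigma>\<close> matches its cycles inside this set with those outside.\<close>
lemma even_card_perm_cycles_if_strict: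
  assumes f: "\<And>x. x \<in> A \<Longrightarrow> f x \<noteq> (f (\<sigma> x) :: nat)" and g: "g \<in> G" "\<And>x. x \<in> A \<Longrightarrow> f (g x) = f x"
  shows "even (card (perm_cycles A g))"
proof -
  define L where "L = {x\<in>A. f x < f (\<sigma> x)}"
  note perm = permutes[OF g(1)]
  \<comment> \<open>The colour of the partner is invariant too, because \<open>g\<close> commutes
    with \<open>\<sigma>\<close>; hence each cycle lies inside \<open>L\<close> or outside
    it.\<close>
  have fs: "f (\<sigma> (g x)) = f (\<sigma> x)" if "x \<in> A" for x
    using commute[OF g(1) that] g(2)[OF partner(1)[OF that]] by simp
  have orb: "y \<in> A \<and> (y \<in> L \<longleftrightarrow> x \<in> L)" if "y \<in> orbit g x" "x \<in> A" for x y
    using that by induction (auto simp: L_def g fs mem_iff)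
  have sL: "\<sigma> ` L = A - L"
  proof (intro equalityI subsetI)
    fix y assume y: "y \<in> A - L"
    hence "\<sigma> y \<in> L" using partner[of y] f[of y] by (auto simp: L_def)
    thus "y \<in> \<sigma> ` L" using partner(3)[of y] y by force
  qed (use partner in \<open>auto simp: L_def\<close>)
  have orbs: "orbit g (\<sigma> x) = \<sigma> ` orbit g x" if "x \<in> A" for x
    by (rule orbit_inverse[symmetric])
      (use self_in_orbit_permutes[OF finite_points perm] commute[OF g(1)] orb that in auto)
  have inj: "inj_on ((`) \<sigma>) (orbit g ` L)"
  proof (rule inj_on_subset[OF inj_on_image_Pow])
    show "inj_on \<sigma> A" using partner(3) by (metis inj_onI)
    show "orbit g ` L \<subseteq> Pow A" using orb by (auto simp: L_def)
  qed
  have "perm_cycles A g = orbit g ` L \<union> orbit g ` (A - L)"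
    unfolding perm_cycles_def by (auto simp: L_def)
  also have "orbit g ` (A - L) = (`) \<sigma> ` orbit g ` L"
    using orbs unfolding sL[symmetric] by (force simp: L_def image_image)
  finally have C: "perm_cycles A g = orbit g ` L \<union> (`) \<sigma> ` orbit g ` L" .
  have "orbit g ` L \<inter> (`) \<sigma> ` orbit g ` L = {}"
  proof (rule ccontr)
    assume "orbit g ` L \<inter> (`) \<sigma> ` orbit g ` L \<noteq> {}"
    then obtain x y where xy: "x \<in> L" "y \<in> L" "orbit g x = \<sigma> ` orbit g y" by blast
    hence "x \<in> \<sigma> ` orbit g y" using self_in_orbit_permutes[OF finite_points perm, of x] by simp
    moreover have "orbit g y \<subseteq> L" using orb xy(2) by (auto simp: L_def)
    ultimately show False using xy(1) sL by blast
  qed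
  hence "card (perm_cycles A g) = card (orbit g ` L) + card (orbit g ` L)"
    unfolding C using card_image[OF inj] finite_points by (subst card_Un_disjoint) (auto simp: L_def)
  thus ?thesis by simp
qed

text \<open>This is the reciprocity of a star after removing the factor \<open>q\<close> due to its
  centre.\<close>

lemma sum_invariant_eq_sum_signed:
  "(\<Sum>g\<in>G. real (q - 1) ^ card (perm_cycles A g)) = (\<Sum>g\<in>G. (- real q) ^ card (perm_cycles A g))"
proof -
  let ?s = "\<lambda>g. (-1::real) ^ card (perm_cycles A g)"
  have finW: "finite (A \<rightarrow>\<^sub>E {..<m::nat})" for m using finite_points by (simp add: finite_PiE)
  have finS: "finite (strict_colourings q)"
    by (rule finite_subset[OF _ finW[of q]]) (auto simp: strict_colourings_def)
  have "(\<Sum>g\<in>G. real (q - 1) ^ card (perm_cycles A g)) =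
      real (\<Sum>g\<in>G. card {f \<in> A \<rightarrow>\<^sub>E {..<q - 1}. \<forall>x\<in>A. f (g x) = f x})"
    using card_invariant_colourings[OF finite_points permutes] by (simp add: invariant_colourings_def)
  also have "(\<Sum>g\<in>G. card {f \<in> A \<rightarrow>\<^sub>E {..<q - 1}. \<forall>x\<in>A. f (g x) = f x}) =
      (\<Sum>\<tau>\<in>types q. card {g\<in>G. \<forall>x\<in>A. \<tau> (g x) = \<tau> x})"
    by (rule sum_card_fixed_types[OF finW _ type_of_weak_colourings])
      (use mem_iff in \<open>auto simp: PiE_def Pi_def\<close>)
  also have "\<dots> = (\<Sum>g\<in>G. card {f \<in> strict_colourings q. \<forall>x\<in>A. f (g x) = f x})"
  proof (rule sum_card_fixed_types[OF finS _ type_of_strict_colourings, symmetric])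
    fix f g assume f: "f \<in> strict_colourings q" and g: "g \<in> G"
    have "f (g x) < q \<and> f (g x) \<noteq> f (g (\<sigma> x))" if "x \<in> A" for x
      using f mem_iff[OF g, of x] commute[OF g that] that by (auto simp: strict_colourings_def)
    thus "(\<lambda>x\<in>A. f (g x)) \<in> strict_colourings q"
      using partner(1) by (auto simp: strict_colourings_def)
  qed (auto simp: strict_colourings_def PiE_def)
  also have "\<dots> = (\<Sum>f\<in>strict_colourings q. card {g\<in>G. \<forall>x\<in>A. f (g x) = f x})"
    using sum.swap_restrict[OF finite_group finS, of "\<lambda>_ _. 1::nat" "\<lambda>g f. \<forall>x\<in>A. f (g x) = f x"] by simp
  also have "real \<dots> = (\<Sum>f\<in>strict_colourings q. \<Sum>g\<in>{g\<in>G. \<forall>x\<in>A. f (g x) = f x}. ?s g)"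
  proof -
    have "?s g = 1" if "f \<in> strict_colourings q" "g \<in> {g\<in>G. \<forall>x\<in>A. f (g x) = f x}" for f g
      using even_card_perm_cycles_if_strict[of f g] that by (simp add: strict_colourings_def)
    thus ?thesis by simp
  qed
  also have "\<dots> = (\<Sum>f\<in>A \<rightarrow>\<^sub>E {..<q}. \<Sum>g\<in>{g\<in>G. \<forall>x\<in>A. f (g x) = f x}. ?s g)"
  proof (rule sum.mono_neutral_left[OF finW])
    show "\<forall>f\<in>(A \<rightarrow>\<^sub>E {..<q}) - strict_colourings q. (\<Sum>g\<in>{g\<in>G. \<forall>x\<in>A. f (g x) = f x}. ?s g) = 0"
    proof
      fix f assume "f \<in> (A \<rightarrow>\<^sub>E {..<q}) - strict_colourings q"
      then obtain x where x: "x \<in> A" "f x = f (\<sigma> x)" by (auto simp: strict_colourings_def)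
      show "(\<Sum>g\<in>{g\<in>G. \<forall>x\<in>A. f (g x) = f x}. ?s g) = 0"
        by (rule signed_stabiliser_sum_eq_0[of A G x "\<sigma> x"])
          (use x partner[OF x(1)] finite_points permutes comp_mem swap_mem in auto)
    qed
  qed (auto simp: strict_colourings_def)
  also have "\<dots> = (\<Sum>g\<in>G. (- real q) ^ card (perm_cycles A g))"
    using signed_invariant_colourings_sum[OF finite_points finite_group permutes, of q]
    by (simp add: power_mult_distrib[symmetric])
  finally show ?thesis .
qed

end

section \<open>Automorphism groups as permutation groups\<close>

lemma group_aut_group: "group (aut_group \<Gamma>)"
proof (rule groupI)
  fix g assume g: "g \<in> carrier (aut_group \<Gamma>)"
  hence perm: "g permutes pverts \<Gamma>" by (simp add: mem_aut_group_iff)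
  have inv: "inv_into UNIV g permutes pverts \<Gamma>" using perm by (rule permutes_inv)
  have "(inv_into UNIV g u, inv_into UNIV g v) \<in> parcs \<Gamma> \<longleftrightarrow> (u, v) \<in> parcs \<Gamma>"
    if "u \<in> pverts \<Gamma>" "v \<in> pverts \<Gamma>" for u v
    using g that permutes_inverses(1)[OF perm] permutes_in_image[OF inv] unfolding mem_aut_group_iff by metis
  hence "inv_into UNIV g \<in> carrier (aut_group \<Gamma>)" using inv by (simp add: mem_aut_group_iff)
  moreover have "inv_into UNIV g \<otimes>\<^bsub>aut_group \<Gamma>\<^esub> g = \<one>\<^bsub>aut_group \<Gamma>\<^esub>"
    using permutes_inv_o(2)[OF perm] by (simp add: aut_group_def symmetric_group_on_def)
  ultimately show "\<exists>h\<in>carrier (aut_group \<Gamma>). h \<otimes>\<^bsub>aut_group \<Gamma>\<^esub> g = \<one>\<^bsub>aut_group \<Gamma>\<^esub>" by blast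
qed (auto simp: aut_group_def symmetric_group_on_def permutes_id permutes_compose permutes_in_image comp_assoc)

lemma aut_group_inv:
  assumes "g \<in> carrier (aut_group \<Gamma>)"
  shows "m_inv (aut_group \<Gamma>) g = inv_into UNIV g"
proof -
  interpret group "aut_group \<Gamma>" by (rule group_aut_group)
  have perm: "g permutes pverts \<Gamma>" using assms by (simp add: mem_aut_group_iff)
  have "m_inv (aut_group \<Gamma>) g \<circ> g = id"
    using l_inv[OF assms] by (simp add: aut_group_def symmetric_group_on_def)
  hence "m_inv (aut_group \<Gamma>) g \<circ> (g \<circ> inv_into UNIV g) = inv_into UNIV g"
    by (simp only: comp_assoc[symmetric] id_comp)
  thus ?thesis using permutes_inv_o(1)[OF perm] by simp
qed

lemma perm_group_subgroup_aut_group: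
  assumes "subgroup G (aut_group \<Gamma>)" "finite (pverts \<Gamma>)"
  shows "perm_group (pverts \<Gamma>) G"
proof
  interpret subgroup G "aut_group \<Gamma>" by fact
  fix g h assume g: "g \<in> G"
  show "g permutes pverts \<Gamma>" using g mem_carrier mem_aut_group_iff by blast
  show "inv_into UNIV g \<in> G" using m_inv_closed[OF g] aut_group_inv[OF mem_carrier[OF g]] by simp
  assume "h \<in> G"
  thus "g \<circ> h \<in> G" using m_closed[OF g] by (simp add: aut_group_def symmetric_group_on_def)
next
  interpret subgroup G "aut_group \<Gamma>" by fact
  show "id \<in> G" using one_closed by (simp add: aut_group_def symmetric_group_on_def)
qed (use assms in simp)

text \<open>Every permutation is an automorphism of the edgeless graph, so the computation of
  inverses carries over to the symmetric group.\<close>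

lemma symmetric_group_on_eq_aut_group:
  "symmetric_group_on V = aut_group \<lparr>pverts = V, parcs = {}\<rparr>"
  by (simp add: symmetric_group_on_def aut_group_def)

lemma pair_swap_group_subset_iff:
  assumes "perm_group V G" "\<Union>M \<subseteq> V"
  shows "pair_swap_group V M \<subseteq> G \<longleftrightarrow> (\<forall>a b. {a, b} \<in> M \<longrightarrow> transpose a b \<in> G)"
proof
  assume "pair_swap_group V M \<subseteq> G"
  thus "\<forall>a b. {a, b} \<in> M \<longrightarrow> transpose a b \<in> G"
    unfolding pair_swap_group_def by (blast intro: generate.incl)
next
  interpret perm_group V G by fact
  assume *: "\<forall>a b. {a, b} \<in> M \<longrightarrow> transpose a b \<in> G"
  show "pair_swap_group V M \<subseteq> G"
  proof
    fix g assume "g \<in> pair_swap_group V M"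
    thus "g \<in> G" unfolding pair_swap_group_def
    proof induction
      case one
      have "\<one>\<^bsub>symmetric_group_on V\<^esub> = id" by (simp add: symmetric_group_on_def)
      thus ?case using id_mem by (simp only:)
    next
      case (inv h)
      then obtain a b where ab: "h = transpose a b" "{a, b} \<in> M" by blast
      hence "h permutes V" using assms(2) by (auto intro!: permutes_swap_id)
      hence "m_inv (symmetric_group_on V) h = inv_into UNIV h"
        unfolding symmetric_group_on_eq_aut_group by (intro aut_group_inv) (simp add: mem_aut_group_iff)
      also have "\<dots> = h" unfolding ab by (rule inv_transpose_eq)
      finally show ?case using * ab by simp
    next
      case (eng g h)
      have "g \<otimes>\<^bsub>symmetric_group_on V\<^esub> h = g \<circ> h" by (simp add: symmetric_group_on_def)
      thus ?case using comp_mem eng by (simp only:)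
    qed (use * in blast)
  qed
qed

section \<open>Reciprocal pairs\<close>

lemma poly_cycle_poly_neg:
  "poly (smult ((-1) ^ n) (pcompose (cycle_poly V G) [:0, -1:])) x =
    (-1) ^ n * (\<Sum>g\<in>G. (- x) ^ card (perm_cycles V g))"
  by (simp add: cycle_poly_def poly_pcompose poly_sum poly_monom)

lemma perm_cycles_insert_fixed_point:
  assumes "finite V" "g permutes V" "c \<in> V" "g c = c"
  shows "card (perm_cycles V g) = Suc (card (perm_cycles (V - {c}) g))"
proof -
  have "orbit g c = {c}" using assms by (simp add: orbit_eq_singleton_iff)
  moreover have "c \<notin> orbit g x" if "x \<noteq> c" for x
    using orbit_cyclic_eq3[OF cyclic_on_orbit[OF assms(2,1)], of c x]
      self_in_orbit_permutes[OF assms(1,2), of x] calculation that by auto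
  hence "{c} \<notin> perm_cycles (V - {c}) g" by (auto simp: perm_cycles_def)
  moreover have "perm_cycles V g = insert (orbit g c) (perm_cycles (V - {c}) g)"
    using assms(3) by (auto simp: perm_cycles_def)
  ultimately show ?thesis using finite_perm_cycles[of "V - {c}" g] assms(1) by simp
qed

lemma partition_into_pairs_partner:
  assumes "partition_on L M" "\<forall>B\<in>M. card B = 2"
  obtains \<sigma> where "\<And>x. x \<in> L \<Longrightarrow> \<sigma> x \<noteq> x \<and> {x, \<sigma> x} \<in> M" "\<And>x y. {x, y} \<in> M \<Longrightarrow> \<sigma> x = y"
proof -
  have ne: "x \<noteq> y" if "{x, y} \<in> M" for x y using assms(2) that by fastforce
  have ex: "\<exists>y. {x, y} \<in> M" if x: "x \<in> L" for x
  proof -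
    obtain B where B: "B \<in> M" "x \<in> B" using assms(1) x by (auto simp: partition_on_def)
    have "card B = 2" using assms(2) B(1) by blast
    then obtain a b where "B = {a, b}" by (auto simp: card_2_iff)
    thus ?thesis using B by (auto simp: insert_commute)
  qed
  have uniq: "y = z" if "{x, y} \<in> M" "{x, z} \<in> M" for x y z
  proof -
    have "{x, y} = {x, z}" 
      using disjointD[OF partition_onD2[OF assms(1)] that] by (metis IntI empty_iff insertI1)
    thus ?thesis using ne that by (metis doubleton_eq_iff)
  qed
  show thesis
  proof (rule that[of "\<lambda>x. SOME y. {x, y} \<in> M"])
    fix x assume "x \<in> L"
    hence "{x, SOME y. {x, y} \<in> M} \<in> M" using someI_ex[OF ex] by blast
    thus "(SOME y. {x, y} \<in> M) \<noteq> x \<and> {x, SOME y. {x, y} \<in> M} \<in> M" using ne[of x "SOME y. {x, y} \<in> M"] by simp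
  next
    fix x y assume "{x, y} \<in> M"
    thus "(SOME y. {x, y} \<in> M) = y" using uniq someI[of "\<lambda>y. {x, y} \<in> M"] by blast
  qed
qed

text \<open>All of \<open>G\<close> fixes \<open>c\<close>, so the quotient formula applies to every
  element with root \<open>c\<close>, which is a cycle of its own; what remains is an identity for
  the action on the leaves.\<close>

lemma star_reciprocal_pair:
  assumes tree: "is_tree \<Gamma>" and G: "subgroup G (aut_group \<Gamma>)" and odd: "odd (card (pverts \<Gamma>))"
    and c: "c \<in> pverts \<Gamma>" and M: "leaf_pairing \<Gamma> c M"
    and swaps: "pair_swap_group (pverts \<Gamma>) M \<subseteq> G" and stab: "G \<subseteq> pairing_stabiliser (pverts \<Gamma>) c M"
  shows "reciprocal_pair \<Gamma> G"
proof -
  let ?V = "pverts \<Gamma>"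
  let ?L = "?V - {c}"
  have fin: "finite ?V" using is_treeD[OF tree] by blast
  interpret V: perm_group ?V G using perm_group_subgroup_aut_group[OF G fin] .
  have part: "partition_on ?L M" "\<forall>B\<in>M. card B = 2" using M by (auto simp: leaf_pairing_def)
  have UM: "\<Union>M = ?L" using part(1) by (simp add: partition_on_def)
  obtain \<sigma> where s: "\<And>x. x \<in> ?L \<Longrightarrow> \<sigma> x \<noteq> x \<and> {x, \<sigma> x} \<in> M" and s': "\<And>x y. {x, y} \<in> M \<Longrightarrow> \<sigma> x = y"
    by (rule partition_into_pairs_partner[OF part]) blast
  have transp: "transpose a b \<in> G" if "{a, b} \<in> M" for a b
    using pair_swap_group_subset_iff[OF V.perm_group_axioms, of M] UM swaps that by auto
  have gc: "g c = c" and gM: "B \<in> M \<Longrightarrow> g ` B \<in> M" if "g \<in> G" for g B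
    using stab that by (auto simp: pairing_stabiliser_def)
  interpret paired_perm_group ?L G \<sigma>
  proof
    fix g assume g: "g \<in> G"
    show "g permutes ?L"
      using permutes_superset[OF V.permutes[OF g], of ?L] gc[OF g] by auto
    fix x assume x: "x \<in> ?L"
    show "g (\<sigma> x) = \<sigma> (g x)" using s'[of "g x" "g (\<sigma> x)"] gM[OF g, of "{x, \<sigma> x}"] s[OF x] by simp
  next
    fix x assume x: "x \<in> ?L"
    show "\<sigma> x \<in> ?L" using s[OF x] UM by blast
    show "\<sigma> x \<noteq> x" using s[OF x] by blast
    show "\<sigma> (\<sigma> x) = x" using s'[of "\<sigma> x" x] s[OF x] by (simp add: insert_commute)
    show "transpose x (\<sigma> x) \<in> G" using transp s[OF x] by blast
  qed (use fin V.id_mem V.comp_mem V.inv_mem in auto)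
  have cyc: "card (perm_cycles ?V g) = Suc (card (perm_cycles ?L g))" if "g \<in> G" for g
    by (rule perm_cycles_insert_fixed_point[OF fin V.permutes[OF that] c gc[OF that]])
  have chrom: "chromatic_poly (quotient_graph \<Gamma> g) = [:0, 1:] * [:-1, 1:] ^ card (perm_cycles ?L g)" if "g \<in> G" for g
    using chromatic_poly_quotient_graph[OF tree subgroup.mem_carrier[OF G that] c gc[OF that]] cyc[OF that] by simp
  show ?thesis unfolding reciprocal_pair_def
  proof (rule poly_eq_if_eq_on_nats)
    fix q :: nat
    show "poly (orbital_chromatic_poly \<Gamma> G) (real q) =
      poly (smult ((-1) ^ card ?V) (pcompose (cycle_poly ?V G) [:0, -1:])) (real q)"
    proof (cases "q = 0")
      case True
      thus ?thesis unfolding poly_cycle_poly_neg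
        by (simp add: orbital_chromatic_poly_def poly_sum chrom cyc)
    next
      case False
      have "poly (orbital_chromatic_poly \<Gamma> G) (real q) = (\<Sum>g\<in>G. real q * real (q - 1) ^ card (perm_cycles ?L g))"
        using False by (simp add: orbital_chromatic_poly_def poly_sum chrom of_nat_diff)
      also have "\<dots> = (\<Sum>g\<in>G. real q * (- real q) ^ card (perm_cycles ?L g))"
        by (simp only: sum_distrib_left[symmetric] sum_invariant_eq_sum_signed)
      \<comment> \<open>The number of vertices is odd, so its sign cancels the one that the extra
        cycle \<open>{c}\<close> contributes through \<open>- real q\<close>.\<close>
      also have "\<dots> = (-1) ^ card ?V * (\<Sum>g\<in>G. (- real q) ^ card (perm_cycles ?V g))"
        using odd by (simp add: cyc sum_distrib_left sum_negf)
      finally show ?thesis unfolding poly_cycle_poly_neg .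
    qed
  qed
qed

section \<open>From reciprocity to the star\<close>

lemma coeff_linear_power_pred: "coeff ([:-1, 1:] ^ Suc m :: real poly) m = - real (Suc m)"
  by (subst coeff_linear_poly_power) simp_all

text \<open>Comparing the coefficients of \<open>x ^ (n - 1)\<close>: the identity contributes \<open>- (n - 1)\<close> on the left, and each
  transposition contributes \<open>1\<close> on the left and \<open>-1\<close> on the right.\<close>
lemma reciprocal_pair_card_transpositions:
  assumes tree: "is_tree \<Gamma>" and n: "n = card (pverts \<Gamma>)" "n \<ge> 3" and G: "subgroup G (aut_group \<Gamma>)"
    and rec: "reciprocal_pair \<Gamma> G"
  shows "n = 2 * card {g\<in>G. Suc (card (perm_cycles (pverts \<Gamma>) g)) = n} + 1"
proof -
  let ?V = "pverts \<Gamma>"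
  let ?c = "\<lambda>g. card (perm_cycles ?V g)"
  let ?T = "{g\<in>G. Suc (?c g) = n}"
  have fin: "finite ?V" using is_treeD[OF tree] by blast
  interpret perm_group ?V G using perm_group_subgroup_aut_group[OF G fin] .
  note aut = subgroup.mem_carrier[OF G]
  obtain m where m: "n = Suc (Suc m)" "m \<ge> 1" using n(2) by (metis One_nat_def Suc_le_D Suc_le_mono numeral_3_eq_3)
  have chrom: "coeff (chromatic_poly (quotient_graph \<Gamma> g)) (Suc m) =
      (if g = id then - real (Suc m) else 0) + (if Suc (?c g) = n then 1 else 0)" if g: "g \<in> G" for g
  proof -
    consider "g = id" | "Suc (?c g) = n" | "g \<noteq> id" "Suc (?c g) \<noteq> n" by blast
    thus ?thesis
    proof cases
      case 1
      obtain r where r: "r \<in> ?V" using n by (metis card.empty ex_in_conv not_numeral_le_zero)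
      have c: "?c g = n" using 1 n card_perm_cycles_id[of ?V] by simp
      have "chromatic_poly (quotient_graph \<Gamma> g) = [:0, 1:] * [:-1, 1:] ^ Suc m"
        using chromatic_poly_quotient_graph[OF tree aut[OF g] r] 1 c m by simp
      hence "coeff (chromatic_poly (quotient_graph \<Gamma> g)) (Suc m) = - real (Suc m)"
        by (simp add: coeff_linear_power_pred del: power_Suc)
      thus ?thesis using 1 c by simp
    next
      case 2
      then obtain a b where ab: "a \<noteq> b" "a \<in> ?V" "b \<in> ?V" "g = transpose a b"
        using card_perm_cycles_eq_card_minus_one_iff[OF fin permutes[OF g]] n by auto
      \<comment> \<open>With at least three vertices there is one outside \<open>{a, b}\<close>; it
        is fixed and can serve as the root.\<close>
      have "card {a, b} < card ?V" using ab(1) n by simp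
      hence "\<not> ?V \<subseteq> {a, b}" by (meson card_mono finite.emptyI finite.insertI leD)
      then obtain r where r: "r \<in> ?V" "r \<noteq> a" "r \<noteq> b" by blast
      have "chromatic_poly (quotient_graph \<Gamma> g) = [:0, 1:] * [:-1, 1:] ^ m"
        using chromatic_poly_quotient_graph[OF tree aut[OF g] r(1)] r ab(4) 2 m by simp
      hence "coeff (chromatic_poly (quotient_graph \<Gamma> g)) (Suc m) = 1"
        by (simp add: coeff_linear_poly_power)
      moreover have "g \<noteq> id" using ab by (auto simp: transpose_eq_id_iff)
      ultimately show ?thesis using 2 by simp
    next
      case 3
      \<comment> \<open>Here \<open>g\<close> has at most \<open>n - 2\<close> cycles, too few for
        its chromatic polynomial to reach degree \<open>n - 1\<close>.\<close>
      have "?c g \<noteq> n" using card_perm_cycles_eq_iff[OF fin permutes[OF g]] 3 n by simp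
      hence "?c g < Suc m" using card_perm_cycles_le[OF fin, of g] 3 n m by simp
      hence "coeff (chromatic_poly (quotient_graph \<Gamma> g)) (Suc m) = 0"
        using degree_chromatic_poly_quotient_graph_le[OF fin, of g] by (intro coeff_eq_0) simp
      thus ?thesis using 3 by simp
    qed
  qed
  have "coeff (orbital_chromatic_poly \<Gamma> G) (Suc m) = - real (Suc m) + real (card ?T)"
    using finite_group id_mem
    by (simp add: orbital_chromatic_poly_def coeff_sum chrom sum.distrib sum.delta' sum.delta flip: sum.inter_filter)
  moreover have "coeff (smult ((-1) ^ n) (pcompose (cycle_poly ?V G) [:0, -1:])) (Suc m) = - real (card ?T)"
  proof -
    have "coeff (cycle_poly ?V G) (Suc m) = real (card ?T)"
      using finite_group m(1) by (simp add: cycle_poly_def coeff_sum flip: sum.inter_filter)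
    \<comment> \<open>The factor \<open>(-1)^n\<close> meets \<open>(-1)^(n-1)\<close> from
      substituting \<open>-x\<close>, which leaves -1.\<close>
    thus ?thesis using m(1) by (simp add: coeff_pcompose_linear flip: power_add mult_2)
  qed
  ultimately have "- real (Suc m) + real (card ?T) = - real (card ?T)"
    using rec n(1) by (simp add: reciprocal_pair_def)
  thus ?thesis using m(1) by simp
qed

text \<open>Otherwise all three transpositions of \<open>{a, b, c}\<close> lie in \<open>G\<close> and one of them stabilises any given
  2-colouring, so the right-hand side vanishes at 2; but a tree has a proper 2-colouring.\<close>
lemma reciprocal_pair_no_common_point:
  assumes tree: "is_tree \<Gamma>" and n: "card (pverts \<Gamma>) \<ge> 3" and G: "subgroup G (aut_group \<Gamma>)"
    and rec: "reciprocal_pair \<Gamma> G"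
    and ab: "transpose a b \<in> G" "a \<noteq> b" and ac: "transpose a c \<in> G" "a \<noteq> c"
  shows "b = c"
proof (rule ccontr)
  assume bc: "b \<noteq> c"
  let ?V = "pverts \<Gamma>"
  have fin: "finite ?V" using is_treeD[OF tree] by blast
  interpret perm_group ?V G using perm_group_subgroup_aut_group[OF G fin] .
  \<comment> \<open>The conjugate of \<open>transpose a c\<close> by
    \<open>transpose a b\<close>.\<close>
  have tbc: "transpose b c \<in> G"
    using transpose_conjugate_mem[OF ab(1) ac(1)] ab(2) ac(2) bc by simp
  have "(\<Sum>g\<in>G. (-1) ^ card (perm_cycles ?V g) * real 2 ^ card (perm_cycles ?V g)) =
      (\<Sum>f\<in>?V \<rightarrow>\<^sub>E {..<2::nat}. \<Sum>g\<in>{g\<in>G. \<forall>x\<in>?V. f (g x) = f x}. (-1) ^ card (perm_cycles ?V g))"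
    by (rule signed_invariant_colourings_sum[OF fin finite_group permutes])
  also have "\<dots> = 0"
  proof (rule sum.neutral, rule ballI)
    fix f assume "f \<in> ?V \<rightarrow>\<^sub>E {..<2::nat}"
    moreover have "a \<in> ?V" "b \<in> ?V" "c \<in> ?V" using transposed_points ab ac by blast+
    ultimately have "f a < 2" "f b < 2" "f c < 2" by auto
    then consider "f a = f b" | "f a = f c" | "f b = f c" by linarith
    then obtain x y where xy: "f x = f y" "x \<noteq> y" "transpose x y \<in> G" using ab ac bc tbc by metis
    show "(\<Sum>g\<in>{g\<in>G. \<forall>x\<in>?V. f (g x) = f x}. (-1::real) ^ card (perm_cycles ?V g)) = 0"
      by (rule signed_stabiliser_sum_eq_0[of ?V G x y])
        (use fin permutes transposed_points[OF xy(3,2)] xy comp_mem in auto)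
  qed
  finally have "(\<Sum>g\<in>G. (- 2::real) ^ card (perm_cycles ?V g)) = 0"
    by (simp add: power_mult_distrib[symmetric])
  hence "poly (orbital_chromatic_poly \<Gamma> G) 2 = 0"
    using rec poly_cycle_poly_neg[of "card ?V" ?V G 2] by (simp add: reciprocal_pair_def)
  \<comment> \<open>The identity contributes 2, and all other terms are numbers of proper
    2-colourings.\<close>
  moreover have "poly (orbital_chromatic_poly \<Gamma> G) 2 > 0"
    unfolding orbital_chromatic_poly_def poly_sum
  proof (rule sum_pos2[OF finite_group id_mem])
    have "a \<in> ?V" using transposed_points ab by blast
    thus "poly (chromatic_poly (quotient_graph \<Gamma> id)) 2 > 0"
      using chromatic_poly_quotient_graph[OF tree subgroup.mem_carrier[OF G id_mem]] by simp
    show "poly (chromatic_poly (quotient_graph \<Gamma> g)) 2 \<ge> 0" for g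
      using poly_chromatic_poly_quotient_graph[OF fin, of g 2] by simp
  qed
  ultimately show False by simp
qed

text \<open>Every neighbour of \<open>a\<close> is also a neighbour of \<open>b\<close>, so two of
  them are joined through \<open>b\<close> without meeting \<open>a\<close>.\<close>

lemma transposed_vertex_is_leaf:
  assumes tree: "is_tree \<Gamma>" and n: "card (pverts \<Gamma>) \<ge> 3"
    and t: "transpose a b \<in> carrier (aut_group \<Gamma>)" "a \<noteq> b"
    and xy: "(a, x) \<in> parcs \<Gamma>" "(a, y) \<in> parcs \<Gamma>"
  shows "x = y"
proof -
  let ?V = "pverts \<Gamma>"
  note T = is_treeD[OF tree]
  have a: "a \<in> ?V" using xy(1) T(3) by blast
  have perm: "transpose a b permutes ?V" using t(1) by (simp add: mem_aut_group_iff)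
  hence b: "b \<in> ?V" using permutes_in_image[OF perm, of a] a by simp
  have arcs: "(transpose a b u, transpose a b v) \<in> parcs \<Gamma> \<longleftrightarrow> (u, v) \<in> parcs \<Gamma>" if "u \<in> ?V" "v \<in> ?V" for u v
    using t(1) that by (simp add: mem_aut_group_iff)
  have "card {a, b} < card ?V" using t(2) n by simp
  hence "\<not> ?V \<subseteq> {a, b}" by (meson card_mono finite.emptyI finite.insertI leD)
  then obtain r where r: "r \<in> ?V" "r \<noteq> a" "r \<noteq> b" by blast
  \<comment> \<open>Equal distance from the fixed vertex \<open>r\<close> excludes an edge between
    \<open>a\<close> and \<open>b\<close>.\<close>
  have "depth (parcs \<Gamma>) r b = depth (parcs \<Gamma>) r a"
    using depth_automorphism[OF tree t(1) r(1) a] r by simp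
  hence nadj: "(a, b) \<notin> parcs \<Gamma>" using tree_depth_neq[OF tree r(1)] by metis
  have nb: "(z, b) \<in> parcs \<Gamma> \<and> (b, z) \<in> parcs \<Gamma> \<and> z \<noteq> a" if z: "(a, z) \<in> parcs \<Gamma>" for z
  proof -
    have "z \<noteq> a" "z \<noteq> b" "z \<in> ?V" using z nadj T(3,5) by blast+
    hence "(b, z) \<in> parcs \<Gamma>" using arcs[OF a, of z] z by simp
    thus ?thesis using T(4) \<open>z \<noteq> a\<close> by blast
  qed
  have "(x, y) \<in> (parcs \<Gamma> \<inter> (- {a}) \<times> (- {a}))\<^sup>*"
    using nb[OF xy(1)] nb[OF xy(2)] t(2)
    by (intro rtrancl_trans[OF r_into_rtrancl r_into_rtrancl, of x b _ y]) auto
  thus ?thesis using tree_neighbours_eq_if_connected[OF tree xy] by blast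
qed

text \<open>A parent other than \<open>c\<close> would have its own parent and its child as
  neighbours; being a leaf, it forces them to coincide, against their depths.\<close>

lemma star_centre_if_others_leaves:
  assumes tree: "is_tree \<Gamma>" and c: "c \<in> pverts \<Gamma>"
    and leaf: "\<And>v x y. v \<in> pverts \<Gamma> \<Longrightarrow> v \<noteq> c \<Longrightarrow> (v, x) \<in> parcs \<Gamma> \<Longrightarrow> (v, y) \<in> parcs \<Gamma> \<Longrightarrow> x = y"
  shows "star_centre \<Gamma> c"
  unfolding star_centre_def
proof (intro conjI ballI)
  fix v assume v: "v \<in> pverts \<Gamma> - {c}"
  note T = is_treeD[OF tree]
  obtain p where p: "\<And>v. v \<in> pverts \<Gamma> \<Longrightarrow> v \<noteq> c \<Longrightarrow> (p v, v) \<in> parcs \<Gamma> \<and> depth (parcs \<Gamma>) c (p v) < depth (parcs \<Gamma>) c v"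
    by (rule tree_parent[OF tree c]) blast
  have pv: "(p v, v) \<in> parcs \<Gamma>" "depth (parcs \<Gamma>) c (p v) < depth (parcs \<Gamma>) c v" "p v \<in> pverts \<Gamma>"
    using p[of v] v T(3) by auto
  have "p v = c"
  proof (rule ccontr)
    assume "p v \<noteq> c"
    hence "(p (p v), p v) \<in> parcs \<Gamma>" "depth (parcs \<Gamma>) c (p (p v)) < depth (parcs \<Gamma>) c (p v)" using p pv by auto
    moreover have "p (p v) = v"
      using leaf[of "p v" "p (p v)" v] pv T(4)[of "p (p v)" "p v"] calculation \<open>p v \<noteq> c\<close> by blast
    ultimately show False using pv by simp
  qed
  thus "(c, v) \<in> parcs \<Gamma>" using pv by simp
qed (rule c)

lemma reciprocal_pair_imp_star:
  assumes tree: "is_tree \<Gamma>" and n: "n = card (pverts \<Gamma>)" "n \<ge> 3" and G: "subgroup G (aut_group \<Gamma>)"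
    and rec: "reciprocal_pair \<Gamma> G"
  obtains c M where "n = 2 * card M + 1" "star_centre \<Gamma> c" "leaf_pairing \<Gamma> c M"
    "pair_swap_group (pverts \<Gamma>) M \<subseteq> G" "G \<subseteq> pairing_stabiliser (pverts \<Gamma>) c M"
proof -
  let ?V = "pverts \<Gamma>"
  let ?T = "{g\<in>G. Suc (card (perm_cycles ?V g)) = n}"
  have fin: "finite ?V" using is_treeD[OF tree] by blast
  interpret perm_group ?V G using perm_group_subgroup_aut_group[OF G fin] .
  \<comment> \<open>The pairing is read off the transpositions in \<open>G\<close>; its blocks are
    disjoint because distinct transpositions in \<open>G\<close> share no point.\<close>
  define M where "M = {{a, b} | a b. a \<noteq> b \<and> transpose a b \<in> G}"
  have memM: "{a, b} \<in> M \<longleftrightarrow> a \<noteq> b \<and> transpose a b \<in> G" for a b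
    unfolding M_def by (auto simp: doubleton_eq_iff transpose_commute)
  have MV: "\<Union>M \<subseteq> ?V" using transposed_points by (auto simp: M_def)
  have card2: "card B = 2" if "B \<in> M" for B using that by (auto simp: M_def)
  have disj: "B = B'" if BB: "B \<in> M" "B' \<in> M" "x \<in> B" "x \<in> B'" for B B' x
  proof -
    obtain y where y: "B = {x, y}" using card2[OF BB(1)] BB(3) by (auto simp: card_2_iff)
    obtain z where z: "B' = {x, z}" using card2[OF BB(2)] BB(4) by (auto simp: card_2_iff)
    have "y = z" using reciprocal_pair_no_common_point[OF tree _ G rec, of x y z] n BB(1,2) memM
      unfolding y z by blast
    thus ?thesis using y z by simp
  qed
  have T: "?T = {transpose a b | a b. a \<noteq> b \<and> transpose a b \<in> G}"
    using card_perm_cycles_eq_card_minus_one_iff[OF fin permutes] n(1) transposed_points by fastforce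
  have supp: "{x. transpose a b x \<noteq> x} = {a, b}" if "a \<noteq> b" for a b :: 'a
    using that by (auto simp: transpose_def split: if_splits)
  \<comment> \<open>A transposition is determined by its support, so \<open>M\<close> has as many
    blocks as \<open>G\<close> has transpositions, namely \<open>(n - 1)/2\<close>.\<close>
  have "bij_betw (\<lambda>g. {x. g x \<noteq> x}) ?T M"
  proof (rule bij_betw_imageI)
    show "inj_on (\<lambda>g. {x. g x \<noteq> x}) ?T"
      unfolding T by (rule inj_onI) (auto simp: supp doubleton_eq_iff transpose_commute)
    show "(\<lambda>g. {x. g x \<noteq> x}) ` ?T = M"
      unfolding T M_def using supp by (auto simp: image_iff) blast
  qed
  hence nM: "n = 2 * card M + 1"
    using reciprocal_pair_card_transpositions[OF tree n G rec] bij_betw_same_card by fastforce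
  have "card (\<Union>M) = 2 * card M"
  proof -
    have "finite B" if "B \<in> M" for B using card2[OF that] by (simp add: card_ge_0_finite)
    moreover have "pairwise disjnt M" using disj by (auto simp: pairwise_def disjnt_def)
    ultimately show ?thesis using card2 by (simp add: card_Union_disjoint mult.commute)
  qed
  \<comment> \<open>The blocks cover \<open>n - 1\<close> points; the one vertex left over will be
    the centre.\<close>
  hence "card (?V - \<Union>M) = 1"
    using card_Diff_subset[OF finite_subset[OF MV fin] MV] nM n(1) by simp
  then obtain c where c: "?V - \<Union>M = {c}" by (auto simp: card_1_singleton_iff)
  hence UM: "\<Union>M = ?V - {c}" "c \<in> ?V" using MV by auto
  have part: "leaf_pairing \<Gamma> c M"
    unfolding leaf_pairing_def
  proof (intro conjI ballI partition_onI)
    show "\<And>p q. p \<in> M \<Longrightarrow> q \<in> M \<Longrightarrow> p \<noteq> q \<Longrightarrow> disjnt p q" using disj by (auto simp: disjnt_def)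
    show "{} \<notin> M" using card2 by force
  qed (use UM card2 in auto)
  have star: "star_centre \<Gamma> c"
  proof (rule star_centre_if_others_leaves[OF tree UM(2)])
    fix v x y assume v: "v \<in> ?V" "v \<noteq> c" and xy: "(v, x) \<in> parcs \<Gamma>" "(v, y) \<in> parcs \<Gamma>"
    obtain B where B: "B \<in> M" "v \<in> B" using v UM by blast
    then obtain w where "B = {v, w}" using card2[OF B(1)] by (auto simp: card_2_iff)
    hence "v \<noteq> w" "transpose v w \<in> G" using B memM by auto
    thus "x = y"
      using transposed_vertex_is_leaf[OF tree _ subgroup.mem_carrier[OF G] _ xy] n by blast
  qed
  \<comment> \<open>Conjugation by \<open>g\<close> permutes the transpositions of \<open>G\<close>,
    so \<open>g\<close> permutes the blocks and must fix the only uncovered vertex.\<close>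
  have gM: "g ` B \<in> M" if g: "g \<in> G" and B: "B \<in> M" for g B
  proof -
    obtain a b where ab: "B = {a, b}" "a \<noteq> b" "transpose a b \<in> G" using B by (auto simp: M_def)
    have "g a \<noteq> g b" using permutes_inj[OF permutes[OF g]] ab(2) by (auto dest: injD)
    thus ?thesis using transpose_conjugate_mem[OF g ab(3)] memM ab(1) by simp
  qed
  have "G \<subseteq> pairing_stabiliser ?V c M"
  proof
    fix g assume g: "g \<in> G"
    have "g c \<notin> \<Union>M"
    proof
      assume "g c \<in> \<Union>M"
      then obtain B where B: "B \<in> M" "g c \<in> B" by blast
      hence "inv_into UNIV g (g c) \<in> inv_into UNIV g ` B" by blast
      hence "c \<in> \<Union>M" using gM[OF inv_mem[OF g] B(1)] permutes_inverses(2)[OF permutes[OF g]] by auto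
      thus False using UM by blast
    qed
    hence gc: "g c = c" using UM mem_iff[OF g, of c] by blast
    have "(\<lambda>B. g ` B) ` M = M"
    proof (intro equalityI subsetI)
      fix B assume B: "B \<in> M"
      have "B = g ` (inv_into UNIV g ` B)"
        using permutes_inverses(1)[OF permutes[OF g]] by (simp add: image_image)
      thus "B \<in> (\<lambda>B. g ` B) ` M" using gM[OF inv_mem[OF g] B] by blast
    qed (use gM[OF g] in blast)
    thus "g \<in> pairing_stabiliser ?V c M"
      using gc permutes[OF g] by (simp add: pairing_stabiliser_def symmetric_group_on_def)
  qed
  moreover have "pair_swap_group ?V M \<subseteq> G"
    using pair_swap_group_subset_iff[OF perm_group_axioms MV] memM by blast
  ultimately show thesis using that nM star part by blast
qed

theorem theorem4p1:
  fixes \<Gamma> :: "'a pair_pre_digraph" and G :: "('a \<Rightarrow> 'a) set" and n :: nat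
  assumes "is_tree \<Gamma>"
    and "n = card (pverts \<Gamma>)"
    and "n \<ge> 3"
    and "subgroup G (aut_group \<Gamma>)"
  shows "reciprocal_pair \<Gamma> G \<longleftrightarrow>
    odd n \<and>
    is_star \<Gamma> \<and>
    (\<exists>k c M. n = 2 * k + 1 \<and> star_centre \<Gamma> c \<and> leaf_pairing \<Gamma> c M \<and> card M = k \<and>
       pair_swap_group (pverts \<Gamma>) M \<subseteq> G \<and>
       G \<subseteq> pairing_stabiliser (pverts \<Gamma>) c M)"
    (is "_ \<longleftrightarrow> ?R")
proof
  assume "reciprocal_pair \<Gamma> G"
  from reciprocal_pair_imp_star[OF assms this]
  obtain c M where cM: "n = 2 * card M + 1" "star_centre \<Gamma> c" "leaf_pairing \<Gamma> c M"
    "pair_swap_group (pverts \<Gamma>) M \<subseteq> G" "G \<subseteq> pairing_stabiliser (pverts \<Gamma>) c M" by metis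
  hence "odd n" by simp
  thus ?R using cM assms(1) unfolding is_star_def by blast
next
  assume ?R
  then obtain c M where "odd n" "star_centre \<Gamma> c" "leaf_pairing \<Gamma> c M"
    "pair_swap_group (pverts \<Gamma>) M \<subseteq> G" "G \<subseteq> pairing_stabiliser (pverts \<Gamma>) c M" by blast
  thus "reciprocal_pair \<Gamma> G"
    using star_reciprocal_pair[OF assms(1,4)] assms(2) by (auto simp: star_centre_def)
qed

end
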